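(* Let $\alpha>0$, $x^0\ne x^*$, $\epsilon>0$, $\kappa_1=L(\Lambda_1)/\alpha$, $d(\Lambda_1)=\|\lambda^*\|+1$. To find an $\epsilon$-close solution, i.e. $\bar x^N$ with $\|\bar x^N-x^*\|^2\le\epsilon$, run the ACGD-S method with the stepsize rule $\mathrm{SC}(L(\Lambda_1),R)$ (method and rule described in the context) with $R=d(\Lambda_1)/\|x^0-x^*\|$. Then the required numbers $N_\epsilon$ of first-order-oracle evaluations and $C_\epsilon$ of matrix-vector multiplications are bounded by $$N_\epsilon\le\Big\lceil(\sqrt{2\kappa_1}+1)\log\Big(1+\frac{3\sqrt{2\kappa_1}\,\|x^0-x^*\|^2}{\epsilon}\Big)\Big\rceil+4,$$ $$C_\epsilon=O\Big\{N_\epsilon+\frac{\bar M\,d(\Lambda_1)}{\|x^0-x^*\|\sqrt{\alpha L(\Lambda_1)}}\sqrt{\max\Big\{1,\frac{6\kappa_1\|x^0-x^*\|^2}{\epsilon}\Big\}}\Big\}.$$ In the nontrivial accuracy regime $\epsilon\le6\kappa_1\|x^0-x^*\|^2$, the second bound simplifies to $C_\epsilon=O\big(\bar M\,d(\Lambda_1)/(\alpha\sqrt\epsilon)+N_\epsilon\big)$. All $O$-constants are absolute. Here $\bar M$ is an upper bound for $\max\{1,\|\nabla g(x)\|\}$ over the bounded neighborhood of $x^*$ in which the points $\underline x^t$ remain.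
   Context: Problem: $\min_{x\in X}\{F(x):=f(x)+u(x)\}$ subject to $g(x)\le 0$, where $X\subseteq\mathbb R^n$ is closed and convex, $f:\mathbb R^n\to\mathbb R$ and $g=(g_1,\dots,g_m):\mathbb R^n\to\mathbb R^m$ are convex (componentwise) and differentiable with Lipschitz continuous gradients, and $u$ is a convex, $\alpha$-strongly convex function. Norms are Euclidean (operator norm for matrices), $\nabla g(x)$ is the $m\times n$ Jacobian. There is a KKT pair: $x^*\in X$ optimal, $\lambda^*\in\mathbb R^m_+$ with $-[\nabla f(x^* )+\sum_i\lambda_i^*\nabla g_i(x^* )+u']\in N_X(x^* )$ for some $u'\in\partial u(x^* )$, $g(x^* )\le0$, $\lambda^*_ig_i(x^* )=0$ for all $i$. For $\lambda\in\mathbb R^m_+$, $L_\lambda$ is a Lipschitz constant on $\mathbb R^n$ of the gradient of $f+\sum_i\lambda_ig_i$; $L(\Lambda)=\sup_{\lambda\in\Lambda}L_\lambda$; $\Lambda_r=\{0\}\cup\{\lambda^*+\lambda:\lambda\in\mathbb R^m_+,\|\lambda\|\le r\}$. Convention: the Lipschitz constant $L_f$ of $\nabla f$ is chosen with $L_f\ge\alpha$, so $\kappa_1\ge1$. ACGD-S method: $x^{-1}=\underline x^0=y^{(1)}_0=x^0\in X$, $\pi^0=\nabla f(x^0)$, $\nu^0=\nabla g(x^0)$, $\lambda^{(1)}_{-1}=\lambda^{(1)}_0=0$. For phases $t=1,2,\dots,N$: 1. $\tilde x^t=x^{t-1}+\theta_t(x^{t-1}-x^{t-2})$, $\underline x^t=(\tau_t\underline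 x^{t-1}+\tilde x^t)/(1+\tau_t)$, $\pi^t=\nabla f(\underline x^t)$, $\nu^t=\nabla g(\underline x^t)$; compute $S_t$ and the inner parameters. 2. For $s=1,\dots,S_t$: $\tilde h^{(t),s}=(\nu^t)^\top\lambda^{(t)}_0+\rho^{(t)}_1(\nu^{t-1})^\top(\lambda^{(t)}_0-\lambda^{(t)}_{-1})$ if $s=1$, and $\tilde h^{(t),s}=(\nu^t)^\top\lambda^{(t)}_{s-1}+\rho^{(t)}_s(\nu^t)^\top(\lambda^{(t)}_{s-1}-\lambda^{(t)}_{s-2})$ otherwise; $y^{(t)}_s=\operatorname{argmin}_{y\in X}\langle\tilde h^{(t),s}+\pi^t,y\rangle+u(y)+\frac{\eta_t}2\|y-x^{t-1}\|^2+\frac{\beta^{(t)}_s}2\|y-y^{(t)}_{s-1}\|^2$; $\lambda^{(t)}_s=\operatorname{argmax}_{\lambda\in\mathbb R^m_+}\langle\lambda,\nu^t(y^{(t)}_s-\underline x^t)+g(\underline x^t)\rangle-\frac{\gamma^{(t)}_s}2\|\lambda-\lambda^{(t)}_{s-1}\|^2$. 3. $\lambda^{(t+1)}_0=\lambda^{(t)}_{S_t}$, $\lambda^{(t+1)}_{-1}=\lambda^{(t)}_{S_t-1}$, $y^{(t+1)}_0=y^{(t)}_{S_t}$; $x^t=\sum_s\delta^{(t)}_sy^{(t)}_s/\sum_s\delta^{(t)}_s$. Output $\bar x^N=\sum_{t\le N}\omega_tx^t/\sum_{t\le N}\omega_t$. One oracle evaluation is made per phase, and each inner iteration uses fewer than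 three matrix-vector multiplications. Rule $\mathrm{SC}(L,R)$: with $\kappa=L/\alpha$, $\tau_t=\min\{\frac{t-1}2,\sqrt{2\kappa}\}$, $\eta_t=L/\tau_{t+1}$, $\theta_t=\tau_t/(\tau_{t-1}+1)$, $\omega_1=1$, $\omega_t=\omega_{t-1}/\theta_t$ ($t\ge2$). $M_t=\|\nu^t\|$ if $\|\nu^t\|>0$, else $1$; $\Delta=R^2/(\alpha L)$. Phase 1: $S_1=\min\{S\in\mathbb N_+:\sum_{s=1}^Ss\ge\omega_1M_1^2\Delta\}$, $\Gamma_1\ge0$ solves $\sum_{s=1}^{S_1}s=\Gamma_1^2\omega_1M_1^2\Delta$, $\delta^{(1)}_s=s/\Gamma_1$, $\beta^{(1)}_s=\frac\alpha4(s-1)$, $\gamma^{(1)}_s=\frac4\alpha M_1^2\Gamma_1/\delta^{(1)}_s$, $W_2=\delta^{(1)}_{S_1}/M_1$. Phase $t\ge2$: $S_t=\min\{S\in\mathbb N_+:\sum_{s=1}^S[W_tM_t+(s-1)]\ge\omega_tM_t^2\Delta\}$, $\Gamma_t\ge0$ solves $\sum_{s=1}^{S_t}[\Gamma_tW_tM_t+(s-1)]=\Gamma_t^2\omega_tM_t^2\Delta$, $\delta^{(t)}_s=W_tM_t+(s-1)/\Gamma_t$, $\gamma^{(t)}_s=\frac4\alpha M_t^2\Gamma_t/\delta^{(t)}_s$, $\beta^{(t)}_1=\frac\alpha4W_t\Gamma_tM_t$, $\beta^{(t)}_s=\frac\alpha4[W_t\Gamma_tM_t+(s-2)]$ ($s\ge2$),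 $W_{t+1}=\delta^{(t)}_{S_t}/M_t$. Finally $\rho^{(t)}_s=\delta^{(t)}_{s-1}/\delta^{(t)}_s$ for $s\ge2$, $\rho^{(t)}_1=w^{(t-1)}_{S_{t-1}}/w^{(t)}_1$ for $t\ge2$ with $w^{(t)}_s=\omega_t\delta^{(t)}_s/\sum_{s'}\delta^{(t)}_{s'}$. *)

theory Defs
  imports "HOL-Analysis.Analysis"
begin

section \<open>Convex problems with function constraints\<close>

definition gradient :: "('a::real_inner \<Rightarrow> real) \<Rightarrow> 'a \<Rightarrow> 'a" where
  "gradient f x = (THE D. GDERIV f x :> D)"

definition strongly_convex_on :: "'a::real_normed_vector set \<Rightarrow> real \<Rightarrow> ('a \<Rightarrow> real) \<Rightarrow> bool" where
  "strongly_convex_on S \<alpha> u \<longleftrightarrow> convex S \<and>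
     (\<forall>x\<in>S. \<forall>y\<in>S. \<forall>t\<in>{0..1}.
        u ((1 - t) *\<^sub>R x + t *\<^sub>R y)
          \<le> (1 - t) * u x + t * u y - \<alpha> / 2 * t * (1 - t) * (norm (x - y))\<^sup>2)"

text \<open>The subdifferential of \<open>u\<close> regarded as a function with effective domain \<open>S\<close>;
  values of \<open>u\<close> outside \<open>S\<close> play no role.\<close>

definition subdifferential :: "'a::real_inner set \<Rightarrow> ('a \<Rightarrow> real) \<Rightarrow> 'a \<Rightarrow> 'a set" where
  "subdifferential S u x = {v. \<forall>y\<in>S. u x + v \<bullet> (y - x) \<le> u y}"

definition normal_cone :: "'a::real_inner set \<Rightarrow> 'a \<Rightarrow> 'a set" where
  "normal_cone S x = {v. \<forall>y\<in>S. v \<bullet> (y - x) \<le> 0}"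

definition orthant :: "(real^'m) set" where
  "orthant = {l. \<forall>i. 0 \<le> l $ i}"

definition jac :: "(real^'n \<Rightarrow> real^'m) \<Rightarrow> real^'n \<Rightarrow> real^'n^'m" where
  "jac g x = jacobian g (at x)"

definition matrix_norm :: "real^'n^'m \<Rightarrow> real" where
  "matrix_norm A = onorm ((*v) A)"

definition kkt_pair ::
  "(real^'n) set \<Rightarrow> (real^'n \<Rightarrow> real) \<Rightarrow> (real^'n \<Rightarrow> real^'m) \<Rightarrow> (real^'n \<Rightarrow> real)
    \<Rightarrow> real^'n \<Rightarrow> real^'m \<Rightarrow> bool" where
  "kkt_pair X f g u xs ls \<longleftrightarrow>
     is_arg_min (\<lambda>x. f x + u x) (\<lambda>x. x \<in> X \<and> (\<forall>i. g x $ i \<le> 0)) xs \<and>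
     ls \<in> orthant \<and>
     (\<exists>u'\<in>subdifferential X u xs.
        - (gradient f xs + (\<Sum>i\<in>UNIV. ls $ i *\<^sub>R gradient (\<lambda>x. g x $ i) xs) + u')
          \<in> normal_cone X xs) \<and>
     (\<forall>i. ls $ i * g xs $ i = 0)"

definition dual_region :: "real^'m \<Rightarrow> real \<Rightarrow> (real^'m) set" where
  "dual_region ls r = insert 0 {ls + l | l. l \<in> orthant \<and> norm l \<le> r}"

text \<open>\<open>Lc l\<close> is a chosen Lipschitz constant, not necessarily the least one.\<close>

definition lagrangian_smoothness ::
  "(real^'n \<Rightarrow> real) \<Rightarrow> (real^'n \<Rightarrow> real^'m) \<Rightarrow> (real^'m \<Rightarrow> real) \<Rightarrow> bool" where
  "lagrangian_smoothness f g Lc \<longleftrightarrow>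
     (\<forall>l\<in>orthant. (Lc l)-lipschitz_on UNIV
        (gradient (\<lambda>x. f x + (\<Sum>i\<in>UNIV. l $ i * g x $ i))))"

section \<open>The ACGD-S method\<close>

text \<open>The first index of the parameters and iterates is the phase \<open>t \<ge> 1\<close>, the second one the
  inner iteration \<open>s\<close>. Since the stepsizes do not depend on the number of phases \<open>N\<close>, a run is
  an infinite sequence of phases, of which the first \<open>N\<close> are used for the output.\<close>

record stepsizes =
  sz_tau :: "nat \<Rightarrow> real"
  sz_theta :: "nat \<Rightarrow> real"
  sz_eta :: "nat \<Rightarrow> real"
  sz_omega :: "nat \<Rightarrow> real"
  sz_inner :: "nat \<Rightarrow> nat"
  sz_delta :: "nat \<Rightarrow> nat \<Rightarrow> real"
  sz_beta :: "nat \<Rightarrow> nat \<Rightarrow> real"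
  sz_gamma :: "nat \<Rightarrow> nat \<Rightarrow> real"
  sz_rho :: "nat \<Rightarrow> nat \<Rightarrow> real"

text \<open>\<open>it_x t\<close>, \<open>it_xu t\<close>, \<open>it_y t s\<close>, \<open>it_lam t s\<close> are $x^t$, $\underline x^t$, $y^{(t)}_s$,
  $\lambda^{(t)}_s$ (with \<open>s \<ge> 0\<close>), and \<open>it_lam_prev t\<close> is $\lambda^{(t)}_{-1}$.\<close>

record ('n::finite, 'm::finite) iterates =
  it_x :: "nat \<Rightarrow> real^'n"
  it_xu :: "nat \<Rightarrow> real^'n"
  it_y :: "nat \<Rightarrow> nat \<Rightarrow> real^'n"
  it_lam :: "nat \<Rightarrow> nat \<Rightarrow> real^'m"
  it_lam_prev :: "nat \<Rightarrow> real^'m"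

definition momentum ::
  "(real^'n \<Rightarrow> real^'m) \<Rightarrow> stepsizes \<Rightarrow> ('n::finite, 'm::finite) iterates \<Rightarrow> nat \<Rightarrow> nat \<Rightarrow> real^'n" where
  "momentum g P Z t s =
     (let \<nu> = (\<lambda>t. jac g (it_xu Z t)) in
      if s = 1 then
        transpose (\<nu> t) *v it_lam Z t 0
          + sz_rho P t 1 *\<^sub>R (transpose (\<nu> (t - 1)) *v (it_lam Z t 0 - it_lam_prev Z t))
      else
        transpose (\<nu> t) *v it_lam Z t (s - 1)
          + sz_rho P t s *\<^sub>R (transpose (\<nu> t) *v (it_lam Z t (s - 1) - it_lam Z t (s - 2))))"

text \<open>For \<open>t = 1\<close> the truncated index \<open>t - 2 = 0\<close> gives $x^{-1} = x^0$, as required.\<close>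

definition acgd_s ::
  "(real^'n) set \<Rightarrow> (real^'n \<Rightarrow> real) \<Rightarrow> (real^'n \<Rightarrow> real^'m) \<Rightarrow> (real^'n \<Rightarrow> real)
    \<Rightarrow> real^'n \<Rightarrow> stepsizes \<Rightarrow> ('n::finite, 'm::finite) iterates \<Rightarrow> bool" where
  "acgd_s X f g u x0 P Z \<longleftrightarrow>
     x0 \<in> X \<and> it_x Z 0 = x0 \<and> it_xu Z 0 = x0 \<and> it_y Z 1 0 = x0 \<and>
     it_lam Z 1 0 = 0 \<and> it_lam_prev Z 1 = 0 \<and>
     (\<forall>t\<ge>1.
        it_xu Z t = (1 / (1 + sz_tau P t)) *\<^sub>R
          (sz_tau P t *\<^sub>R it_xu Z (t - 1)
            + (it_x Z (t - 1) + sz_theta P t *\<^sub>R (it_x Z (t - 1) - it_x Z (t - 2)))) \<and>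
        (\<forall>s\<in>{1..sz_inner P t}.
           is_arg_min
             (\<lambda>y. (momentum g P Z t s + gradient f (it_xu Z t)) \<bullet> y + u y
                  + sz_eta P t / 2 * (norm (y - it_x Z (t - 1)))\<^sup>2
                  + sz_beta P t s / 2 * (norm (y - it_y Z t (s - 1)))\<^sup>2)
             (\<lambda>y. y \<in> X) (it_y Z t s) \<and>
           is_arg_max
             (\<lambda>l. l \<bullet> (jac g (it_xu Z t) *v (it_y Z t s - it_xu Z t) + g (it_xu Z t))
                  - sz_gamma P t s / 2 * (norm (l - it_lam Z t (s - 1)))\<^sup>2)
             (\<lambda>l. l \<in> orthant) (it_lam Z t s)) \<and>
        it_lam Z (t + 1) 0 = it_lam Z t (sz_inner P t) \<and>
        it_lam_prev Z (t + 1) = it_lam Z t (sz_inner P t - 1) \<and>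
        it_y Z (t + 1) 0 = it_y Z t (sz_inner P t) \<and>
        it_x Z t = (1 / (\<Sum>s=1..sz_inner P t. sz_delta P t s)) *\<^sub>R
          (\<Sum>s=1..sz_inner P t. sz_delta P t s *\<^sub>R it_y Z t s))"

definition acgd_output :: "stepsizes \<Rightarrow> ('n::finite, 'm::finite) iterates \<Rightarrow> nat \<Rightarrow> real^'n" where
  "acgd_output P Z N =
     (1 / (\<Sum>t=1..N. sz_omega P t)) *\<^sub>R (\<Sum>t=1..N. sz_omega P t *\<^sub>R it_x Z t)"

definition phase_norm :: "(real^'n \<Rightarrow> real^'m) \<Rightarrow> ('n::finite, 'm::finite) iterates \<Rightarrow> nat \<Rightarrow> real" where
  "phase_norm g Z t =
     (let M = matrix_norm (jac g (it_xu Z t)) in if M > 0 then M else 1)"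

definition inner_weight :: "stepsizes \<Rightarrow> nat \<Rightarrow> nat \<Rightarrow> real" where
  "inner_weight P t s = sz_omega P t * sz_delta P t s / (\<Sum>s'=1..sz_inner P t. sz_delta P t s')"

section \<open>The stepsize rule for strongly convex problems\<close>

text \<open>\<open>M t\<close> stands for $M_t$. The rule divides by $\Gamma_t$, so the root $\Gamma_t$ has to be positive:
  if $S_t = 1$ in a phase $t \ge 2$, then $0$ also solves the equation for $\Gamma_t$. The value
  $\rho^{(1)}_1$ is left open; it only multiplies $\lambda^{(1)}_0 - \lambda^{(1)}_{-1} = 0$.\<close>

definition sc_rule :: "real \<Rightarrow> real \<Rightarrow> real \<Rightarrow> (nat \<Rightarrow> real) \<Rightarrow> stepsizes \<Rightarrow> bool" where
  "sc_rule \<alpha> L R M P \<longleftrightarrow>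
     (let \<kappa> = L / \<alpha>; \<Delta> = R\<^sup>2 / (\<alpha> * L); \<omega> = sz_omega P; S = sz_inner P; \<delta> = sz_delta P in
      (\<forall>t. sz_tau P t = min ((real t - 1) / 2) (sqrt (2 * \<kappa>))) \<and>
      (\<forall>t\<ge>1. sz_eta P t = L / sz_tau P (t + 1)) \<and>
      (\<forall>t\<ge>1. sz_theta P t = sz_tau P t / (sz_tau P (t - 1) + 1)) \<and>
      \<omega> 1 = 1 \<and> (\<forall>t\<ge>2. \<omega> t = \<omega> (t - 1) / sz_theta P t) \<and>
      (\<exists>\<Gamma> W :: nat \<Rightarrow> real.
         S 1 = (LEAST k. k \<ge> 1 \<and> (\<Sum>s=1..k. real s) \<ge> \<omega> 1 * (M 1)\<^sup>2 * \<Delta>) \<and>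
         \<Gamma> 1 > 0 \<and> (\<Sum>s=1..S 1. real s) = (\<Gamma> 1)\<^sup>2 * \<omega> 1 * (M 1)\<^sup>2 * \<Delta> \<and>
         (\<forall>s\<in>{1..S 1}.
            \<delta> 1 s = real s / \<Gamma> 1 \<and>
            sz_beta P 1 s = \<alpha> / 4 * (real s - 1) \<and>
            sz_gamma P 1 s = 4 / \<alpha> * (M 1)\<^sup>2 * \<Gamma> 1 / \<delta> 1 s) \<and>
         (\<forall>t\<ge>2.
            S t = (LEAST k. k \<ge> 1 \<and>
                     (\<Sum>s=1..k. W t * M t + (real s - 1)) \<ge> \<omega> t * (M t)\<^sup>2 * \<Delta>) \<and>
            \<Gamma> t > 0 \<and>
            (\<Sum>s=1..S t. \<Gamma> t * W t * M t + (real s - 1)) = (\<Gamma> t)\<^sup>2 * \<omega> t * (M t)\<^sup>2 * \<Delta> \<and>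
            (\<forall>s\<in>{1..S t}.
               \<delta> t s = W t * M t + (real s - 1) / \<Gamma> t \<and>
               sz_gamma P t s = 4 / \<alpha> * (M t)\<^sup>2 * \<Gamma> t / \<delta> t s \<and>
               sz_beta P t s = \<alpha> / 4 *
                 (W t * \<Gamma> t * M t + (if s = 1 then 0 else real s - 2)))) \<and>
         (\<forall>t\<ge>1. W (t + 1) = \<delta> t (S t) / M t)) \<and>
      (\<forall>t\<ge>1. \<forall>s\<in>{2..S t}. sz_rho P t s = \<delta> t (s - 1) / \<delta> t s) \<and>
      (\<forall>t\<ge>2. sz_rho P t 1 = inner_weight P (t - 1) (S (t - 1)) / inner_weight P t 1))"

section \<open>Complexity measures\<close>

text \<open>Each phase makes one oracle evaluation, so the number of oracle evaluations needed to find an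
  \<open>\<epsilon>\<close>-close point is the number of the first phase whose output is \<open>\<epsilon>\<close>-close.\<close>

definition close_output ::
  "stepsizes \<Rightarrow> ('n::finite, 'm::finite) iterates \<Rightarrow> real^'n \<Rightarrow> real \<Rightarrow> nat \<Rightarrow> bool" where
  "close_output P Z xs \<epsilon> N \<longleftrightarrow> 1 \<le> N \<and> (norm (acgd_output P Z N - xs))\<^sup>2 \<le> \<epsilon>"

definition oracle_evaluations ::
  "stepsizes \<Rightarrow> ('n::finite, 'm::finite) iterates \<Rightarrow> real^'n \<Rightarrow> real \<Rightarrow> nat" where
  "oracle_evaluations P Z xs \<epsilon> = (LEAST N. close_output P Z xs \<epsilon> N)"

text \<open>\<open>mv t s\<close> is the number of matrix-vector multiplications in inner iteration \<open>s\<close> of phase \<open>t\<close>.\<close>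

definition matvec_count :: "(nat \<Rightarrow> nat \<Rightarrow> nat) \<Rightarrow> stepsizes \<Rightarrow> nat \<Rightarrow> nat" where
  "matvec_count mv P N = (\<Sum>t=1..N. \<Sum>s=1..sz_inner P t. mv t s)"

text \<open>The absolute constant hidden in the O-notation. It is a numeral rather than an
  existentially quantified number because the latter could depend on the type variables
  \<open>'n\<close>, \<open>'m\<close>, that is, on the dimensions.\<close>

definition O_const :: real where
  "O_const = 100"

end

theory Submission
  imports Defs
begin

text \<open>Only one multiplier matters for the distance to the solution, namely \<open>ls\<close> itself. Put
\<open>F = f + ls \<bullet> g\<close>. The KKT conditions say that \<open>xs\<close> minimises \<open>F + u\<close> over \<open>X\<close> with value
\<open>f xs + u xs\<close>, and strong convexity of \<open>u\<close> gives growth \<open>\<alpha> / 2\<close> times the squared distance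
(\<open>kkt_growth\<close>). So it suffices to bound \<open>F + u\<close> at the output.

Outer loop. With \<open>A t = \<omega> 1 + \<dots> + \<omega> t\<close> the extrapolation rule turns out to place
$\underline x^t$ at the average of $\bar x^{t-1}$ and $x^{t-1}$ with weights \<open>A (t - 1)\<close> and \<open>\<omega> t\<close>
(\<open>A_xu\<close>). This is Nesterov's accelerated method for the \<open>L\<close>-smooth function \<open>F\<close>, which reduces the
task to one linearised saddle point problem per phase (\<open>accelerated_descent\<close>).

Inner loop. Each phase runs a primal-dual method with extrapolated dual steps on that saddle point
problem. Weighted by \<open>inner_weight\<close>, its steps decrease a potential \<open>\<Phi>\<close> that is carried over from one
phase to the next (\<open>inner_step\<close>, \<open>phase_change\<close>). The modulus \<open>\<alpha>\<close> is spent in two halves: one half pays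
for the growth of \<open>\<beta>\<close> inside the phases, the other one for the growth of \<open>\<omega> t * \<eta> t\<close> from phase to
phase (\<open>outer_weights\<close>). The condition \<open>\<Gamma> t \<ge> 1\<close>, which expresses that the inner iterations of phase \<open>t\<close>
reach their target, makes the cross terms at a change of phase harmless.
Everything telescopes (\<open>energy_bound\<close>). The initial energy is at most three times \<open>L\<close> times the
squared initial distance, because \<open>R\<close> is chosen such that the dual part contributes at most twice
this quantity. Hence $A_N \|\bar x^N - x^*\|^2 \le 6 \kappa_1 \|x^0 - x^*\|^2$ (\<open>convergence\<close>).

Number of phases. With \<open>q = sqrt (2 * \<kappa>\<^sub>1)\<close> the weights \<open>\<omega> t\<close> increase linearly until \<open>\<tau> t\<close> reaches \<open>q\<close>
and then by the factor \<open>1 + 1 / q\<close> in each phase. At the switch the linear weights are still ahead of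
the geometric sequence started at phase 5, so \<open>\<omega> t \<ge> (1 + 1 / q) ^ (t - 5)\<close> throughout
(\<open>omega_ge_power\<close>), and summing a geometric series gives the logarithmic bound.

Number of inner iterations. The quantity \<open>W\<close> handed from phase to phase satisfies
\<open>(W (t + 1))\<^sup>2 \<le> 2 * \<Delta> * A t\<close> (\<open>W_sq_le\<close>), whereas a phase with at least three inner iterations
has \<open>\<Gamma> t < 3\<close> and so increases \<open>W\<close> by at least \<open>(S t - 1) / (3 * M t)\<close> (\<open>inner_le\<close>). Summing the
increments bounds the number of all inner iterations (\<open>sum_inner_le\<close>). As \<open>A\<close> at most triples in one
phase and is below the target one phase before the first success, this yields the bound in terms of
the accuracy.\<close>

section \<open>Gradients and smoothness\<close>

lemma gradient_eqI:
  assumes "(f has_derivative (\<lambda>h. D \<bullet> h)) (at x)"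
  shows "gradient f x = D"
  unfolding gradient_def
proof (rule the_equality)
  show "GDERIV f x :> D"
    using assms by (simp add: gderiv_def inner_commute)
  fix E assume "GDERIV f x :> E"
  then have "(\<lambda>h. h \<bullet> E) = (\<lambda>h. D \<bullet> h)"
    unfolding gderiv_def using assms has_derivative_unique by blast
  then have "(E - D) \<bullet> (E - D) = 0"
    by (metis inner_commute inner_diff_left right_minus_eq)
  then show "E = D" by simp
qed

lemma has_derivative_gradient:
  fixes f :: "'a::euclidean_space \<Rightarrow> real"
  assumes "f differentiable (at x)"
  shows "(f has_derivative (\<lambda>h. gradient f x \<bullet> h)) (at x)"
proof -
  obtain f' where f': "(f has_derivative f') (at x)"
    using assms by (auto simp: differentiable_def)
  define D where "D = (\<Sum>b\<in>Basis. f' b *\<^sub>R b)"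
  have "f' h = D \<bullet> h" for h
  proof -
    have "f' h = f' (\<Sum>b\<in>Basis. (h \<bullet> b) *\<^sub>R b)" by (simp add: euclidean_representation)
    also have "\<dots> = (\<Sum>b\<in>Basis. (h \<bullet> b) * f' b)"
      using has_derivative_linear[OF f'] by (simp add: linear_sum linear_scale)
    also have "\<dots> = D \<bullet> h"
      by (simp add: D_def inner_sum_left inner_commute[of h] mult.commute)
    finally show ?thesis .
  qed
  then have "(f has_derivative (\<lambda>h. D \<bullet> h)) (at x)"
    using f' by (metis (no_types, lifting) ext)
  then show ?thesis using gradient_eqI by metis
qed

lemma has_derivative_jac:
  fixes g :: "real^'n \<Rightarrow> real^'m"
  assumes "g differentiable (at x)"
  shows "(g has_derivative (\<lambda>h. jac g x *v h)) (at x)"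
  using assms unfolding jac_def by (simp add: jacobian_works)

lemma gradient_lagrangian:
  fixes f :: "real^'n \<Rightarrow> real" and g :: "real^'n \<Rightarrow> real^'m"
  assumes "f differentiable (at x)" "g differentiable (at x)"
  shows "((\<lambda>x. f x + l \<bullet> g x) has_derivative
           (\<lambda>h. gradient f x \<bullet> h + l \<bullet> (jac g x *v h))) (at x)"
  by (intro derivative_intros has_derivative_gradient has_derivative_jac assms)

lemma gradient_component:
  fixes g :: "real^'n \<Rightarrow> real^'m"
  assumes "g differentiable (at x)"
  shows "gradient (\<lambda>x. g x $ i) x \<bullet> h = (jac g x *v h) $ i"
proof -
  have "((\<lambda>x. g x $ i) has_derivative (\<lambda>h. (jac g x *v h) $ i)) (at x)"
    using bounded_linear.has_derivative[OF bounded_linear_vec_nth has_derivative_jac[OF assms]] .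
  moreover have "((\<lambda>x. g x $ i) has_derivative (\<lambda>h. gradient (\<lambda>x. g x $ i) x \<bullet> h)) (at x)"
    using calculation by (intro has_derivative_gradient) (auto simp: differentiable_def)
  ultimately show ?thesis
    by (metis has_derivative_unique)
qed

text \<open>Restriction to the line through \<open>x\<close> and \<open>y\<close> reduces this to the one-dimensional tangent inequality.\<close>

lemma tangent_le_of_convex_on:
  fixes f :: "'a::euclidean_space \<Rightarrow> real"
  assumes "convex_on UNIV f" and f': "(f has_derivative f') (at x)"
  shows "f x + f' (y - x) \<le> f y"
proof -
  define \<phi> where "\<phi> = (\<lambda>t::real. f (x + t *\<^sub>R (y - x)))"
  have "convex_on UNIV \<phi>"
  proof (rule convex_onI)
    fix t a b :: real assume t: "0 < t" "t < 1"
    have "x + ((1 - t) *\<^sub>R a + t *\<^sub>R b) *\<^sub>R (y - x)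
        = (1 - t) *\<^sub>R (x + a *\<^sub>R (y - x)) + t *\<^sub>R (x + b *\<^sub>R (y - x))"
      by (simp add: algebra_simps)
    then show "\<phi> ((1 - t) *\<^sub>R a + t *\<^sub>R b) \<le> (1 - t) * \<phi> a + t * \<phi> b"
      using convex_onD[OF assms(1), of t] t unfolding \<phi>_def by simp
  qed simp
  moreover have "(\<phi> has_real_derivative f' (y - x)) (at 0 within UNIV)"
  proof -
    have "((\<lambda>t::real. x + t *\<^sub>R (y - x)) has_derivative (\<lambda>t. t *\<^sub>R (y - x))) (at 0)"
      by (auto intro!: derivative_eq_intros)
    from has_derivative_compose[OF this, of f f'] f'
    have "(\<phi> has_derivative (\<lambda>t. f' (t *\<^sub>R (y - x)))) (at 0)"
      unfolding \<phi>_def by simp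
    then show ?thesis
      by (rule has_derivative_imp_has_field_derivative)
         (simp add: linear_scale[OF has_derivative_linear[OF f']])
  qed
  ultimately have "\<phi> 1 - \<phi> 0 \<ge> f' (y - x) * (1 - 0)"
    by (intro convex_on_imp_above_tangent[of UNIV]) auto
  then show ?thesis by (simp add: \<phi>_def)
qed

text \<open>Along the segment from \<open>x\<close> to \<open>y\<close> the difference of the two sides has a nonpositive derivative, since
the gradient moves by at most \<open>L\<close> times the distance covered.\<close>

lemma quadratic_upper_bound_of_lipschitz_gradient:
  fixes f :: "'a::euclidean_space \<Rightarrow> real"
  assumes diff: "\<And>x. f differentiable (at x)" and lip: "L-lipschitz_on UNIV (gradient f)"
  shows "f y \<le> f x + gradient f x \<bullet> (y - x) + L / 2 * (norm (y - x))\<^sup>2"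
proof -
  define v where "v = y - x"
  define \<phi> where "\<phi> = (\<lambda>t::real. f (x + t *\<^sub>R v) - t * (gradient f x \<bullet> v) - L / 2 * t\<^sup>2 * (norm v)\<^sup>2)"
  have "\<phi> 1 \<le> \<phi> 0"
  proof (rule DERIV_nonpos_imp_nonincreasing[of 0 1 \<phi>])
    fix t :: real assume t: "0 \<le> t" "t \<le> 1"
    have "((\<lambda>t::real. x + t *\<^sub>R v) has_derivative (\<lambda>h. h *\<^sub>R v)) (at t)"
      by (auto intro!: derivative_eq_intros)
    from has_derivative_compose[OF this has_derivative_gradient[OF diff]]
    have "((\<lambda>t. f (x + t *\<^sub>R v)) has_real_derivative gradient f (x + t *\<^sub>R v) \<bullet> v) (at t)"
      by (rule has_derivative_imp_has_field_derivative) simp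
    then have "(\<phi> has_real_derivative
        gradient f (x + t *\<^sub>R v) \<bullet> v - gradient f x \<bullet> v - L * t * (norm v)\<^sup>2) (at t)"
      unfolding \<phi>_def by (auto intro!: derivative_eq_intros)
    moreover have "(gradient f (x + t *\<^sub>R v) - gradient f x) \<bullet> v \<le> (L * (t * norm v)) * norm v"
    proof -
      have "norm (gradient f (x + t *\<^sub>R v) - gradient f x) \<le> L * (t * norm v)"
        using lipschitz_onD[OF lip, of "x + t *\<^sub>R v" x] t by (simp add: dist_norm)
      from order_trans[OF norm_cauchy_schwarz mult_right_mono[OF this norm_ge_zero]]
      show ?thesis .
    qed
    then have "gradient f (x + t *\<^sub>R v) \<bullet> v - gradient f x \<bullet> v - L * t * (norm v)\<^sup>2 \<le> 0"
      by (simp add: inner_diff_left power2_eq_square algebra_simps)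
    ultimately show "\<exists>D. DERIV \<phi> t :> D \<and> D \<le> 0" by blast
  qed simp
  then show ?thesis by (simp add: \<phi>_def v_def)
qed

section \<open>Proximal steps\<close>

text \<open>Behind everything in this section: squared distances satisfy the inequality of strong convexity with
equality, so each proximal term adds exactly its coefficient to the modulus.\<close>

lemma norm_convex_combination:
  fixes x y a :: "'a::real_inner"
  shows "(norm ((1 - t) *\<^sub>R x + t *\<^sub>R y - a))\<^sup>2
    = (1 - t) * (norm (x - a))\<^sup>2 + t * (norm (y - a))\<^sup>2 - t * (1 - t) * (norm (x - y))\<^sup>2"
  unfolding power2_norm_eq_inner
  by (simp add: inner_diff_left inner_diff_right inner_add_left inner_add_right algebra_simps
      power2_eq_square inner_commute)

lemma strongly_convex_on_prox:
  fixes u :: "'a::real_inner \<Rightarrow> real"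
  assumes "strongly_convex_on S \<alpha> u"
  shows "strongly_convex_on S (\<alpha> + \<eta>) (\<lambda>y. p \<bullet> y + u y + \<eta> / 2 * (norm (y - a))\<^sup>2)"
  unfolding strongly_convex_on_def
proof (intro conjI ballI)
  show "convex S" using assms by (simp add: strongly_convex_on_def)
  fix x y and t :: real assume S: "x \<in> S" "y \<in> S" "t \<in> {0..1}"
  define w where "w = (1 - t) *\<^sub>R x + t *\<^sub>R y"
  have eq_p: "p \<bullet> w = (1 - t) * (p \<bullet> x) + t * (p \<bullet> y)"
    by (simp add: w_def inner_add_right)
  have eq_n: "(norm (w - a))\<^sup>2
      = (1 - t) * (norm (x - a))\<^sup>2 + t * (norm (y - a))\<^sup>2 - t * (1 - t) * (norm (x - y))\<^sup>2"
    unfolding w_def by (rule norm_convex_combination)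
  have "u w \<le> (1 - t) * u x + t * u y - \<alpha> / 2 * t * (1 - t) * (norm (x - y))\<^sup>2"
    using assms S unfolding w_def by (simp add: strongly_convex_on_def)
  then have "p \<bullet> w + u w + \<eta> / 2 * (norm (w - a))\<^sup>2
      \<le> (1 - t) * (p \<bullet> x + u x + \<eta> / 2 * (norm (x - a))\<^sup>2)
        + t * (p \<bullet> y + u y + \<eta> / 2 * (norm (y - a))\<^sup>2)
        - (\<alpha> + \<eta>) / 2 * t * (1 - t) * (norm (x - y))\<^sup>2"
    unfolding eq_p eq_n by (simp add: algebra_simps add_divide_distrib diff_divide_distrib)
  then show "p \<bullet> ((1 - t) *\<^sub>R x + t *\<^sub>R y) + u ((1 - t) *\<^sub>R x + t *\<^sub>R y)
        + \<eta> / 2 * (norm ((1 - t) *\<^sub>R x + t *\<^sub>R y - a))\<^sup>2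
      \<le> (1 - t) * (p \<bullet> x + u x + \<eta> / 2 * (norm (x - a))\<^sup>2)
        + t * (p \<bullet> y + u y + \<eta> / 2 * (norm (y - a))\<^sup>2)
        - (\<alpha> + \<eta>) / 2 * t * (1 - t) * (norm (x - y))\<^sup>2"
    unfolding w_def .
qed

lemma le_of_mult_one_minus_le:
  fixes c a :: real
  assumes "\<And>t. 0 < t \<Longrightarrow> t < 1 \<Longrightarrow> c * (1 - t) \<le> a"
  shows "c \<le> a"
proof (rule tendsto_upperbound)
  show "((\<lambda>t. c * (1 - t)) \<longlongrightarrow> c) (at_right 0)"
    by (rule tendsto_eq_intros refl | simp)+
  show "\<forall>\<^sub>F t in at_right 0. c * (1 - t) \<le> a"
    unfolding eventually_at_right_field using assms zero_less_one by blast
qed simp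

text \<open>Comparing the minimiser \<open>y\<close> with the point at fraction \<open>t\<close> on the way to \<open>z\<close> gives the claim with an
additional factor \<open>1 - t\<close>, which disappears as \<open>t\<close> tends to 0.\<close>

lemma strongly_convex_on_arg_min:
  fixes \<phi> :: "'a::real_inner \<Rightarrow> real"
  assumes sc: "strongly_convex_on S \<mu> \<phi>" and y: "is_arg_min \<phi> (\<lambda>y. y \<in> S) y" and z: "z \<in> S"
  shows "\<phi> y + \<mu> / 2 * (norm (y - z))\<^sup>2 \<le> \<phi> z"
proof -
  have "\<mu> / 2 * (norm (y - z))\<^sup>2 * (1 - t) \<le> \<phi> z - \<phi> y" if t: "0 < t" "t < 1" for t
  proof -
    have yS: "y \<in> S" using y by (simp add: is_arg_min_def)
    have "convex S" using sc by (simp add: strongly_convex_on_def)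
    then have "(1 - t) *\<^sub>R y + t *\<^sub>R z \<in> S"
      using yS z t by (simp add: convex_def)
    then have "\<phi> y \<le> \<phi> ((1 - t) *\<^sub>R y + t *\<^sub>R z)"
      using y by (auto simp: is_arg_min_def not_less)
    also have "\<dots> \<le> (1 - t) * \<phi> y + t * \<phi> z - \<mu> / 2 * t * (1 - t) * (norm (y - z))\<^sup>2"
      using sc yS z t by (simp add: strongly_convex_on_def)
    finally have "t * (\<mu> / 2 * (norm (y - z))\<^sup>2 * (1 - t)) \<le> t * (\<phi> z - \<phi> y)"
      by (simp add: algebra_simps)
    then show ?thesis using t by (simp only: mult_le_cancel_left_pos)
  qed
  then have "\<mu> / 2 * (norm (y - z))\<^sup>2 \<le> \<phi> z - \<phi> y"
    by (rule le_of_mult_one_minus_le)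
  then show ?thesis by simp
qed

text \<open>A subgradient at \<open>x\<close> makes \<open>x\<close> a minimiser of \<open>u\<close> minus the linear function, which is still strongly
convex.\<close>

lemma strongly_convex_on_subgradient:
  fixes u :: "'a::real_inner \<Rightarrow> real"
  assumes sc: "strongly_convex_on S \<alpha> u" and v: "v \<in> subdifferential S u x"
    and S: "x \<in> S" "y \<in> S"
  shows "u x + v \<bullet> (y - x) + \<alpha> / 2 * (norm (y - x))\<^sup>2 \<le> u y"
proof -
  have "strongly_convex_on S (\<alpha> + 0) (\<lambda>y. (- v) \<bullet> y + u y + 0 / 2 * (norm (y - x))\<^sup>2)"
    by (rule strongly_convex_on_prox[OF sc])
  then have "strongly_convex_on S \<alpha> (\<lambda>y. (- v) \<bullet> y + u y)" by simp
  moreover have "is_arg_min (\<lambda>y. (- v) \<bullet> y + u y) (\<lambda>y. y \<in> S) x"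
    using v S by (auto simp: is_arg_min_def subdifferential_def inner_diff_right not_less
        algebra_simps)
  ultimately show ?thesis
    using strongly_convex_on_arg_min[of S \<alpha> "\<lambda>y. (- v) \<bullet> y + u y" x y] S(2)
    by (simp add: inner_diff_right norm_minus_commute)
qed

lemma strongly_convex_on_imp_convex_on:
  assumes "strongly_convex_on S \<alpha> u" "0 \<le> \<alpha>"
  shows "convex_on S u"
proof (rule convex_onI)
  show "convex S" using assms by (simp add: strongly_convex_on_def)
  fix t :: real and x y assume a: "0 < t" "t < 1" "x \<in> S" "y \<in> S"
  then have "u ((1 - t) *\<^sub>R x + t *\<^sub>R y)
      \<le> (1 - t) * u x + t * u y - \<alpha> / 2 * t * (1 - t) * (norm (x - y))\<^sup>2"
    using assms by (simp add: strongly_convex_on_def)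
  moreover have "0 \<le> \<alpha> / 2 * t * (1 - t) * (norm (x - y))\<^sup>2" using a assms(2) by simp
  ultimately show "u ((1 - t) *\<^sub>R x + t *\<^sub>R y) \<le> (1 - t) * u x + t * u y" by linarith
qed

text \<open>The three-point inequality: the objective of the proximal step has modulus \<open>\<alpha> + \<eta> + \<beta>\<close>.\<close>

lemma prox_step:
  fixes u :: "'a::real_inner \<Rightarrow> real"
  assumes "strongly_convex_on S \<alpha> u" and "z \<in> S"
    and "is_arg_min (\<lambda>y. p \<bullet> y + u y + \<eta> / 2 * (norm (y - a))\<^sup>2 + \<beta> / 2 * (norm (y - b))\<^sup>2)
           (\<lambda>y. y \<in> S) y"
  shows "p \<bullet> (y - z) + u y - u z \<le>
      \<eta> / 2 * ((norm (a - z))\<^sup>2 - (norm (y - a))\<^sup>2 - (norm (y - z))\<^sup>2)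
    + \<beta> / 2 * ((norm (b - z))\<^sup>2 - (norm (y - b))\<^sup>2 - (norm (y - z))\<^sup>2)
    - \<alpha> / 2 * (norm (y - z))\<^sup>2"
proof -
  have "strongly_convex_on S (\<alpha> + \<eta> + \<beta>) (\<lambda>y. 0 \<bullet> y + (p \<bullet> y + u y + \<eta> / 2 * (norm (y - a))\<^sup>2)
      + \<beta> / 2 * (norm (y - b))\<^sup>2)"
    by (intro strongly_convex_on_prox assms)
  from strongly_convex_on_arg_min[OF this _ assms(2), of y] assms(3)
  show ?thesis
    by (simp add: inner_diff_right algebra_simps add_divide_distrib norm_minus_commute[of z])
qed

lemma convex_orthant: "convex orthant"
  by (auto simp: orthant_def convex_def)

text \<open>The same inequality for the maximisation over the multipliers, where the modulus is only \<open>\<gamma>\<close>.\<close>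

lemma dual_prox_step:
  fixes c :: "real^'m"
  assumes "l \<in> orthant"
    and "is_arg_max (\<lambda>l. l \<bullet> c - \<gamma> / 2 * (norm (l - l0))\<^sup>2) (\<lambda>l. l \<in> orthant) l1"
  shows "(l - l1) \<bullet> c \<le> \<gamma> / 2 * ((norm (l - l0))\<^sup>2 - (norm (l1 - l0))\<^sup>2 - (norm (l - l1))\<^sup>2)"
proof -
  have "strongly_convex_on orthant 0 (\<lambda>l::real^'m. 0)"
    by (simp add: strongly_convex_on_def convex_orthant)
  from strongly_convex_on_prox[OF this, of \<gamma> "- c" l0]
  have "strongly_convex_on orthant \<gamma> (\<lambda>l. - (l \<bullet> c) + \<gamma> / 2 * (norm (l - l0))\<^sup>2)"
    by (simp add: inner_commute)
  moreover have "is_arg_min (\<lambda>l. - (l \<bullet> c) + \<gamma> / 2 * (norm (l - l0))\<^sup>2) (\<lambda>l. l \<in> orthant) l1"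
    using assms(2) by (auto simp: is_arg_max_def is_arg_min_def not_less algebra_simps)
  ultimately have "- (l1 \<bullet> c) + \<gamma> / 2 * (norm (l1 - l0))\<^sup>2 + \<gamma> / 2 * (norm (l1 - l))\<^sup>2
      \<le> - (l \<bullet> c) + \<gamma> / 2 * (norm (l - l0))\<^sup>2"
    by (rule strongly_convex_on_arg_min[OF _ _ assms(1)])
  then show ?thesis
    by (simp add: inner_diff_left algebra_simps norm_minus_commute[of l1 l])
qed

section \<open>The stepsize rule and its outer weights\<close>

lemma sum_arith_progression:
  "(\<Sum>s=1..k. a + (real s - 1)) = real k * a + real k * (real k - 1) / 2"
  by (induction k) (simp_all add: field_simps)

lemma sum_nats_real: "(\<Sum>s=1..k. real s) = real k * (real k + 1) / 2"
  by (induction k) (simp_all add: field_simps)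

text \<open>Compares the geometric with the linear growth of the weights up to the switch. If \<open>n \<le> q\<close>, the left-hand
side is at most \<open>exp 1 \<le> 3\<close>. Otherwise \<open>q < n \<le> 2 * q - 3\<close> forces \<open>n > 3\<close>, and
\<open>n \<le> 2 * q\<close> bounds the left-hand side by \<open>exp 2 \<le> 9\<close>.\<close>

lemma one_plus_inverse_power_le:
  fixes q :: real
  assumes q: "q > 0" and n: "real n \<le> 2 * q - 3"
  shows "(1 + 1 / q) ^ n \<le> real n + 5"
proof -
  have "(1 + 1 / q) ^ n \<le> exp (1 / q) ^ n"
    using q by (intro power_mono exp_ge_add_one_self) auto
  also have "\<dots> = exp (real n / q)"
    by (simp flip: exp_of_nat_mult)
  also have "\<dots> \<le> real n + 5"
  proof (cases "real n \<le> q")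
    case True
    then have "exp (real n / q) \<le> exp 1" using q by simp
    with exp_le show ?thesis by linarith
  next
    case False
    with n have "real n > 3" by linarith
    then have "n \<ge> 4" by linarith
    have "exp (real n / q) \<le> exp (1 + 1)" using q n by (simp add: field_simps)
    also have "\<dots> = exp 1 * exp 1" by (rule exp_add)
    also have "\<dots> \<le> 3 * (3 :: real)" using exp_le by (intro mult_mono) auto
    finally show ?thesis using \<open>n \<ge> 4\<close> by simp
  qed
  finally show ?thesis .
qed

text \<open>The rule \<open>sc_rule\<close> with its existentially quantified sequences \<open>\<Gamma>\<close> and \<open>W\<close> fixed, for arbitrary
positive numbers \<open>M t\<close>, through which alone the weights depend on the iterates.\<close>

locale sc_stepsizes =
  fixes \<alpha> L R :: real and M :: "nat \<Rightarrow> real" and P :: stepsizes and \<Gamma> W :: "nat \<Rightarrow> real"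
  assumes alpha_pos: "0 < \<alpha>" and alpha_le: "\<alpha> \<le> L" and R_pos: "0 < R" and M_pos: "\<And>t. 0 < M t"
    and tau: "\<And>t. sz_tau P t = min ((real t - 1) / 2) (sqrt (2 * (L / \<alpha>)))"
    and eta: "\<And>t. 1 \<le> t \<Longrightarrow> sz_eta P t = L / sz_tau P (t + 1)"
    and theta: "\<And>t. 1 \<le> t \<Longrightarrow> sz_theta P t = sz_tau P t / (sz_tau P (t - 1) + 1)"
    and omega_1: "sz_omega P 1 = 1"
    and omega: "\<And>t. 2 \<le> t \<Longrightarrow> sz_omega P t = sz_omega P (t - 1) / sz_theta P t"
    and inner_1: "sz_inner P 1 = (LEAST k. k \<ge> 1 \<and>
          (\<Sum>s=1..k. real s) \<ge> sz_omega P 1 * (M 1)\<^sup>2 * (R\<^sup>2 / (\<alpha> * L)))"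
    and Gamma_1: "\<Gamma> 1 > 0" "(\<Sum>s=1..sz_inner P 1. real s)
          = (\<Gamma> 1)\<^sup>2 * sz_omega P 1 * (M 1)\<^sup>2 * (R\<^sup>2 / (\<alpha> * L))"
    and params_1: "\<And>s. s \<in> {1..sz_inner P 1} \<Longrightarrow> sz_delta P 1 s = real s / \<Gamma> 1 \<and>
          sz_beta P 1 s = \<alpha> / 4 * (real s - 1) \<and>
          sz_gamma P 1 s = 4 / \<alpha> * (M 1)\<^sup>2 * \<Gamma> 1 / sz_delta P 1 s"
    and inner: "\<And>t. 2 \<le> t \<Longrightarrow> sz_inner P t = (LEAST k. k \<ge> 1 \<and>
          (\<Sum>s=1..k. W t * M t + (real s - 1)) \<ge> sz_omega P t * (M t)\<^sup>2 * (R\<^sup>2 / (\<alpha> * L)))"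
    and Gamma: "\<And>t. 2 \<le> t \<Longrightarrow> \<Gamma> t > 0" "\<And>t. 2 \<le> t \<Longrightarrow>
          (\<Sum>s=1..sz_inner P t. \<Gamma> t * W t * M t + (real s - 1))
            = (\<Gamma> t)\<^sup>2 * sz_omega P t * (M t)\<^sup>2 * (R\<^sup>2 / (\<alpha> * L))"
    and params: "\<And>t s. 2 \<le> t \<Longrightarrow> s \<in> {1..sz_inner P t} \<Longrightarrow>
          sz_delta P t s = W t * M t + (real s - 1) / \<Gamma> t \<and>
          sz_gamma P t s = 4 / \<alpha> * (M t)\<^sup>2 * \<Gamma> t / sz_delta P t s \<and>
          sz_beta P t s = \<alpha> / 4 * (W t * \<Gamma> t * M t + (if s = 1 then 0 else real s - 2))"
    and W: "\<And>t. 1 \<le> t \<Longrightarrow> W (Suc t) = sz_delta P t (sz_inner P t) / M t"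
    and rho: "\<And>t s. 1 \<le> t \<Longrightarrow> s \<in> {2..sz_inner P t} \<Longrightarrow>
          sz_rho P t s = sz_delta P t (s - 1) / sz_delta P t s"
    and rho_1: "\<And>t. 2 \<le> t \<Longrightarrow>
          sz_rho P t 1 = inner_weight P (t - 1) (sz_inner P (t - 1)) / inner_weight P t 1"

lemma sc_rule_imp_sc_stepsizes:
  assumes pos: "0 < \<alpha>" "\<alpha> \<le> L" "0 < R" "\<And>t. 0 < M t" and rule: "sc_rule \<alpha> L R M P"
  shows "\<exists>\<Gamma> W. sc_stepsizes \<alpha> L R M P \<Gamma> W"
  using rule unfolding sc_rule_def Let_def
proof (elim conjE exE, goal_cases)
  case (1 \<Gamma> W)
  \<comment> \<open>the conjunction of all clauses for a phase \<open>t \<ge> 2\<close>\<close>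
  note phase = 1(12)[rule_format]
  show ?case
  proof (rule exI[of _ \<Gamma>], rule exI[of _ W], intro sc_stepsizes.intro pos)
    show "sz_tau P t = min ((real t - 1) / 2) (sqrt (2 * (L / \<alpha>)))" for t
      by (rule 1(1)[rule_format])
    show "sz_eta P t = L / sz_tau P (t + 1)" if "1 \<le> t" for t
      by (rule 1(2)[rule_format, OF that])
    show "sz_theta P t = sz_tau P t / (sz_tau P (t - 1) + 1)" if "1 \<le> t" for t
      by (rule 1(3)[rule_format, OF that])
    show "sz_omega P 1 = 1" by (rule 1(4))
    show "sz_omega P t = sz_omega P (t - 1) / sz_theta P t" if "2 \<le> t" for t
      by (rule 1(5)[rule_format, OF that])
    show "sz_rho P t s = sz_delta P t (s - 1) / sz_delta P t s"
      if "1 \<le> t" "s \<in> {2..sz_inner P t}" for t s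
      by (rule 1(6)[rule_format, OF that])
    show "sz_rho P t 1 = inner_weight P (t - 1) (sz_inner P (t - 1)) / inner_weight P t 1"
      if "2 \<le> t" for t
      by (rule 1(7)[rule_format, OF that])
    show "W (Suc t) = sz_delta P t (sz_inner P t) / M t" if "1 \<le> t" for t
      using 1(13)[rule_format, OF that] by (simp only: Suc_eq_plus1)
  qed ((rule 1(8-10)) | (rule 1(11)[rule_format]
      phase[THEN conjunct1] phase[THEN conjunct2, THEN conjunct1]
      phase[THEN conjunct2, THEN conjunct2, THEN conjunct1]
      phase[THEN conjunct2, THEN conjunct2, THEN conjunct2, rule_format]; assumption))+
qed

context sc_stepsizes begin

abbreviation "\<tau> \<equiv> sz_tau P"
abbreviation "\<omega> \<equiv> sz_omega P"
abbreviation "\<eta> \<equiv> sz_eta P"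
abbreviation "S \<equiv> sz_inner P"
abbreviation "\<delta> \<equiv> sz_delta P"
abbreviation "\<beta> \<equiv> sz_beta P"
abbreviation "w \<equiv> inner_weight P"

definition q :: real where "q = sqrt (2 * (L / \<alpha>))"
definition A :: "nat \<Rightarrow> real" where "A N = (\<Sum>t=1..N. \<omega> t)"
definition \<Delta> :: real where "\<Delta> = R\<^sup>2 / (\<alpha> * L)"

lemma L_pos: "0 < L" using alpha_pos alpha_le by linarith

lemma Delta_pos: "0 < \<Delta>" using R_pos alpha_pos L_pos by (simp add: \<Delta>_def)

lemma q_sq: "q\<^sup>2 = 2 * (L / \<alpha>)" using L_pos alpha_pos by (simp add: q_def)

lemma q_ge_1: "1 \<le> q"
proof -
  have "1 \<le> 2 * (L / \<alpha>)" using alpha_pos alpha_le by (simp add: field_simps)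
  then show ?thesis by (simp add: q_def)
qed

lemma tau_min: "\<tau> t = min ((real t - 1) / 2) q" by (simp add: tau q_def)

lemma tau_1: "\<tau> 1 = 0" using q_ge_1 by (simp add: tau_min)

lemma tau_ge_half: "2 \<le> t \<Longrightarrow> 1 / 2 \<le> \<tau> t" using q_ge_1 by (auto simp: tau_min)

lemma tau_nonneg: "1 \<le> t \<Longrightarrow> 0 \<le> \<tau> t" using q_ge_1 by (auto simp: tau_min)

lemma tau_Suc_le: "\<tau> (Suc t) \<le> \<tau> t + 1 / 2" by (auto simp: tau_min min_def field_simps)

lemma theta_pos: "2 \<le> t \<Longrightarrow> 0 < sz_theta P t"
  using tau_ge_half[of t] tau_nonneg[of "t - 1"]
  by (auto simp: theta intro!: divide_pos_pos add_nonneg_pos)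

lemma omega_Suc:
  assumes "1 \<le> t"
  shows "\<omega> (Suc t) * \<tau> (Suc t) = \<omega> t * (\<tau> t + 1)"
  using tau_ge_half[of "Suc t"] tau_nonneg[of t] assms
  by (simp add: omega theta)

lemma omega_theta:
  assumes "2 \<le> t"
  shows "\<omega> t * sz_theta P t = \<omega> (t - 1)"
  using omega[OF assms] theta_pos[OF assms] by simp

lemma omega_ge_1: "1 \<le> t \<Longrightarrow> 1 \<le> \<omega> t"
proof (induction t rule: dec_induct)
  case (step t)
  have "0 < \<tau> (Suc t)" using tau_ge_half[of "Suc t"] step by simp
  moreover have "\<tau> (Suc t) \<le> \<omega> t * (\<tau> t + 1)"
  proof -
    \<comment> \<open>the step of \<open>\<tau>\<close> is at most 1 / 2, so \<open>\<omega>\<close> does not decrease\<close>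
    have "\<tau> (Suc t) \<le> 1 * (\<tau> t + 1)" using tau_Suc_le[of t] by simp
    also have "\<dots> \<le> \<omega> t * (\<tau> t + 1)"
      using step tau_nonneg[of t] by (intro mult_right_mono) auto
    finally show ?thesis .
  qed
  ultimately show ?case
    using omega_Suc[of t] step by (metis mult_le_cancel_right_pos mult_1)
qed (use omega_1 in simp)

lemma A_Suc: "A (Suc N) = A N + \<omega> (Suc N)" by (simp add: A_def)

lemma A_eq: "1 \<le> N \<Longrightarrow> A N = \<omega> N * (1 + \<tau> N)"
proof (induction N rule: dec_induct)
  case base
  then show ?case using tau_1 omega_1 by (simp add: A_def)
next
  case (step N)
  then show ?case using omega_Suc[of N] by (simp add: A_Suc algebra_simps)
qed

lemma A_eq_Suc: "A N = \<omega> (Suc N) * \<tau> (Suc N)"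
proof (cases "N = 0")
  case True then show ?thesis using tau_1 by (simp add: A_def)
next
  case False then show ?thesis using A_eq[of N] omega_Suc[of N] by (simp add: algebra_simps)
qed

lemma A_ge_1: "1 \<le> N \<Longrightarrow> 1 \<le> A N"
  using omega_ge_1[of N] tau_nonneg[of N] mult_mono[of 1 "\<omega> N" 1 "1 + \<tau> N"] by (simp add: A_eq)

lemma A_Suc_le: "1 \<le> N \<Longrightarrow> A (Suc N) \<le> 3 * A N"
  using tau_ge_half[of "Suc N"] omega_ge_1[of "Suc N"]
    mult_left_mono[of 1 "2 * \<tau> (Suc N)" "\<omega> (Suc N)"]
  by (simp add: A_Suc A_eq_Suc[of N])

lemma eta_ge: "1 \<le> t \<Longrightarrow> L / (1 + \<tau> t) \<le> \<eta> t"
  using tau_Suc_le[of t] tau_ge_half[of "Suc t"] L_pos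
  by (simp add: eta) (intro divide_left_mono, auto intro!: mult_pos_pos)

lemma eta_pos: "1 \<le> t \<Longrightarrow> 0 < \<eta> t"
  using tau_ge_half[of "Suc t"] L_pos by (simp add: eta)

lemma eta_1: "\<eta> 1 = 2 * L"
proof -
  have tau_2: "\<tau> (1 + 1) = 1 / 2" using q_ge_1 by (simp add: tau_min)
  have "\<eta> 1 = L / \<tau> (1 + 1)" by (rule eta) simp
  then show ?thesis unfolding tau_2 by simp
qed

text \<open>The numerical core of \<open>outer_weights\<close>. As long as \<open>\<tau> (t + 2)\<close> is in its linear part, it equals
\<open>\<tau> t + 1\<close>. Once it is capped, the correction term takes over: it is 1 if both factors are capped, and
at least 1 / 2 in the single phase in between.\<close>

lemma tau_growth:
  assumes "1 \<le> t"
  shows "\<tau> t + 1 \<le> \<tau> (t + 2) + \<tau> (t + 1) * \<tau> (t + 2) / q\<^sup>2"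
proof (cases "real (t + 2) - 1 \<le> 2 * q")
  case True
  then have "\<tau> t + 1 = \<tau> (t + 2)" by (auto simp: tau_min min_def field_simps)
  then show ?thesis using tau_nonneg[of "t + 1"] tau_nonneg[of "t + 2"] by simp
next
  case False
  then have 2: "\<tau> (t + 2) = q" by (auto simp: tau_min min_def field_simps)
  show ?thesis
  proof (cases "real t \<le> 2 * q")
    case True
    then have 1: "\<tau> (t + 1) = real t / 2" and 0: "\<tau> t = (real t - 1) / 2"
      by (auto simp: tau_min min_def field_simps)
    have "(real t + 1) / 2 \<le> q + (real t / 2) / q"
    proof -
      have "(real t + 1) * q \<le> 2 * q * q + real t"
      proof -
        have "0 \<le> (2 * q - real t) * q + (real t - q)"
          using False True q_ge_1 assms by (intro add_nonneg_nonneg mult_nonneg_nonneg) auto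
        then show ?thesis by (simp add: algebra_simps)
      qed
      then show ?thesis using q_ge_1 by (simp add: field_simps)
    qed
    then show ?thesis using q_ge_1 unfolding 0 1 2 by (simp add: power2_eq_square field_simps)
  next
    case False
    then have "\<tau> (t + 1) = q" by (auto simp: tau_min min_def field_simps)
    then show ?thesis using q_ge_1 2 by (simp add: power2_eq_square tau_min)
  qed
qed

text \<open>The proximal term around the old point in the next phase is paid for by the one around the new point in
this phase together with half of the strong convexity.\<close>

lemma outer_weights:
  assumes "1 \<le> t"
  shows "\<omega> (Suc t) * \<eta> (Suc t) \<le> \<omega> t * (\<eta> t + \<alpha> / 2)"
proof -
  define a b where "a = \<tau> (Suc t)" and "b = \<tau> (Suc (Suc t))"
  have ab: "0 < a" "0 < b" using tau_ge_half[of "Suc t"] tau_ge_half[of "Suc (Suc t)"] assms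
    by (auto simp: a_def b_def)
  have "\<omega> (Suc t) * \<eta> (Suc t) = \<omega> t * ((\<tau> t + 1) * L / (a * b))"
    using omega_Suc[OF assms] ab assms
    by (simp add: eta field_simps flip: a_def b_def)
  also have "(\<tau> t + 1) * L / (a * b) \<le> (b + a * b / q\<^sup>2) * L / (a * b)"
    using tau_growth[OF assms] ab L_pos
    by (intro divide_right_mono mult_right_mono) (auto simp: a_def b_def)
  also have "\<dots> = \<eta> t + \<alpha> / 2"
    using ab L_pos alpha_pos assms by (simp add: q_sq eta field_simps flip: a_def)
  finally show ?thesis using omega_ge_1[OF assms] by (simp add: mult_left_mono)
qed

section \<open>Geometric growth of the weights\<close>

lemma omega_linear: "1 \<le> t \<Longrightarrow> real t \<le> 2 * q + 1 \<Longrightarrow> \<omega> t = real t"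
proof (induction t rule: dec_induct)
  case (step t)
  then have 1: "\<tau> t = (real t - 1) / 2" "\<tau> (Suc t) = real t / 2"
    by (auto simp: tau_min min_def field_simps)
  then have "\<omega> (Suc t) * (real t / 2) = real t * ((real t - 1) / 2 + 1)"
    using omega_Suc[of t] step unfolding 1 by simp
  then have "real t * \<omega> (Suc t) = real t * real (Suc t)" by (simp add: field_simps)
  then show ?case using step by (subst (asm) mult_left_cancel) auto
qed (use omega_1 in simp)

text \<open>Up to the first phase with \<open>\<tau> t = q\<close>, that is up to \<open>t \<le> 2 * q + 2\<close>, the weights are at least \<open>t\<close>,
which beats the power by \<open>one_plus_inverse_power_le\<close>. Afterwards both sides grow by the same factor.\<close>

lemma omega_ge_power: "5 \<le> t \<Longrightarrow> (1 + 1 / q) ^ (t - 5) \<le> \<omega> t"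
proof (induction t rule: less_induct)
  case (less t)
  have q: "0 < q" using q_ge_1 by simp
  show ?case
  proof (cases "real t \<le> 2 * q + 2")
    case True
    have "real t \<le> \<omega> t"
    proof (cases "real t \<le> 2 * q + 1")
      case True then show ?thesis using omega_linear less by simp
    next
      \<comment> \<open>the first capped phase: dividing by \<open>q\<close> instead of the larger \<open>(t - 1) / 2\<close> only increases the weight\<close>
      case False
      obtain t' where t': "t = Suc t'" using less(2) by (cases t) auto
      have "\<tau> t = q" using False by (simp add: tau_min)
      moreover have "\<tau> t' = (real t - 2) / 2" "\<omega> t' = real t - 1"
        using True less(2) omega_linear[of t'] by (auto simp: t' tau_min)
      ultimately have "\<omega> t * q = (real t - 1) * (real t / 2)"
        using omega_Suc[of t'] less(2) t' by auto
      also have "\<dots> \<ge> (2 * q) * (real t / 2)"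
        using False by (intro mult_right_mono) auto
      finally show ?thesis using q by simp
    qed
    moreover have "(1 + 1 / q) ^ (t - 5) \<le> real (t - 5) + 5"
      using True less(2) q by (intro one_plus_inverse_power_le) auto
    ultimately show ?thesis using less(2) by simp
  next
    case False
    obtain t' where t': "t = Suc t'" using less(2) by (cases t) auto
    show ?thesis
    proof (cases "t' \<ge> 5")
      case True
      have "\<tau> t = q" "\<tau> t' = q" using False by (auto simp: t' tau_min)
      then have "\<omega> t = (1 + 1 / q) * \<omega> t'"
        using omega_Suc[of t'] True q by (simp add: t' field_simps)
      moreover have "(1 + 1 / q) ^ (t' - 5) \<le> \<omega> t'" using less(1)[of t'] True t' by simp
      moreover have "(1 + 1 / q) ^ (t - 5) = (1 + 1 / q) * (1 + 1 / q) ^ (t' - 5)"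
      proof -
        have "t - 5 = Suc (t' - 5)" using True t' by simp
        then show ?thesis by (simp only: power_Suc)
      qed
      ultimately show ?thesis using q by (simp add: mult_left_mono)
    next
      case False
      then have "t = 5" using less(2) t' by simp
      then show ?thesis using omega_ge_1[of 5] by simp
    qed
  qed
qed

text \<open>The right-hand side dominates the sum of the powers for phases 5 to \<open>N\<close>, a geometric series.\<close>

lemma A_ge_power:
  assumes "4 \<le> N"
  shows "q * ((1 + 1 / q) ^ (N - 4) - 1) \<le> A N"
  using assms
proof (induction N rule: dec_induct)
  case base
  then show ?case using A_ge_1[of 4] by simp
next
  case (step N)
  have "q * ((1 + 1 / q) ^ (Suc N - 4) - 1) = q * ((1 + 1 / q) ^ (N - 4) - 1) + (1 + 1 / q) ^ (N - 4)"
  proof -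
    have "Suc N - 4 = Suc (N - 4)" using step by simp
    then show ?thesis using q_ge_1 by (simp only: power_Suc) (simp add: field_simps)
  qed
  also have "\<dots> \<le> A N + \<omega> (Suc N)"
    using step omega_ge_power[of "Suc N"] by (intro add_mono) auto
  finally show ?case by (simp add: A_Suc)
qed

text \<open>Uses \<open>ln (1 + 1 / q) \<ge> 1 / (q + 1)\<close>, which is where the factor \<open>q + 1\<close> in the number of phases
comes from.\<close>

lemma A_ge:
  assumes E: "0 \<le> e" and N: "\<lceil>(q + 1) * ln (1 + e)\<rceil> + 4 \<le> int N"
  shows "q * e \<le> A N"
proof -
  have q: "0 < q" using q_ge_1 by simp
  have "0 \<le> (q + 1) * ln (1 + e)" using q E by simp
  then have "0 \<le> \<lceil>(q + 1) * ln (1 + e)\<rceil>" by linarith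
  then have N4: "4 \<le> N" using N by linarith
  have "(q + 1) * ln (1 + e) \<le> real (N - 4)" using N N4 by linarith
  then have "ln (1 + e) \<le> real (N - 4) * (1 / (q + 1))" using q by (simp add: field_simps)
  also have "\<dots> \<le> real (N - 4) * ln (1 + 1 / q)"
  proof (rule mult_left_mono)
    have "1 - 1 / (1 + 1 / q) \<le> ln (1 + 1 / q)"
      using q ln_le_minus_one[of "inverse (1 + 1 / q)"] ln_inverse[of "1 + 1 / q"]
      by (simp add: add_pos_pos inverse_eq_divide)
    then show "1 / (q + 1) \<le> ln (1 + 1 / q)" using q by (simp add: field_simps)
  qed simp
  also have "\<dots> = ln ((1 + 1 / q) ^ (N - 4))" using q by (simp add: ln_realpow add_pos_pos)
  finally have "1 + e \<le> (1 + 1 / q) ^ (N - 4)" using E q by (simp add: add_pos_pos)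
  then have "q * e \<le> q * ((1 + 1 / q) ^ (N - 4) - 1)" using q by simp
  with A_ge_power[OF N4] show ?thesis by linarith
qed

end

section \<open>The inner weights\<close>

context sc_stepsizes begin

text \<open>Many facts below speak of phase 1 or of inner iteration 1. They serve as rewrite rules only as long
as the simplifier does not turn this index into \<open>Suc 0\<close>.\<close>

declare One_nat_def [simp del]

text \<open>Phase 1 has its own formulas in the rule. With the following two sequences all phases look alike: \<open>S t\<close>
is the least \<open>k \<ge> 1\<close> for which the sum of \<open>c t + (s - 1)\<close> over \<open>s \<le> k\<close> reaches \<open>D t\<close>, and
\<open>\<Gamma> t * \<delta> t s = e t + (s - 1)\<close>. The two differ by the factor \<open>\<Gamma> t\<close> in all phases but the first.\<close>

definition c :: "nat \<Rightarrow> real" where "c t = (if t = 1 then 1 else W t * M t)"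
definition e :: "nat \<Rightarrow> real" where "e t = (if t = 1 then 1 else \<Gamma> t * W t * M t)"
definition D :: "nat \<Rightarrow> real" where "D t = \<omega> t * (M t)\<^sup>2 * \<Delta>"

text \<open>Half of \<open>w t s * \<gamma> t s\<close>, which is the same number in all inner iterations of all phases. This is why
the dual distances telescope without loss.\<close>

definition K :: real where "K = 2 / (\<alpha> * \<Delta>)"

lemma K_pos: "0 < K" using alpha_pos Delta_pos by (simp add: K_def)

lemma D_pos: "1 \<le> t \<Longrightarrow> 0 < D t"
  using omega_ge_1[of t] M_pos[of t] Delta_pos by (simp add: D_def)

lemma Gamma_pos: "1 \<le> t \<Longrightarrow> 0 < \<Gamma> t"
  using Gamma_1(1) Gamma(1)[of t] by (cases "t = 1") auto

lemma inner_Least: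
  assumes "1 \<le> t"
  shows "S t = (LEAST k. 1 \<le> k \<and> D t \<le> real k * c t + real k * (real k - 1) / 2)"
proof (cases "t = 1")
  case True
  have "(\<Sum>s=1..k. real s) = real k * c t + real k * (real k - 1) / 2" for k
    unfolding sum_nats_real c_def using True by (simp add: field_simps)
  then show ?thesis using True inner_1 by (simp add: D_def \<Delta>_def)
next
  case False
  then have "(\<Sum>s=1..k. W t * M t + (real s - 1)) = real k * c t + real k * (real k - 1) / 2" for k
    by (simp only: sum_arith_progression c_def if_False)
  then show ?thesis using False assms inner[of t] by (simp add: D_def \<Delta>_def)
qed

lemma Gamma_eq:
  assumes "1 \<le> t"
  shows "real (S t) * e t + real (S t) * (real (S t) - 1) / 2 = (\<Gamma> t)\<^sup>2 * D t"
proof (cases "t = 1")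
  case True
  have "(\<Sum>s=1..S t. real s) = real (S t) * e t + real (S t) * (real (S t) - 1) / 2"
    unfolding sum_nats_real e_def using True by (simp add: field_simps)
  then show ?thesis using True Gamma_1(2) by (simp add: D_def \<Delta>_def)
next
  case False
  then have "(\<Sum>s=1..S t. \<Gamma> t * W t * M t + (real s - 1))
      = real (S t) * e t + real (S t) * (real (S t) - 1) / 2"
    by (simp only: sum_arith_progression e_def if_False)
  then show ?thesis using False assms Gamma(2)[of t] by (simp add: D_def \<Delta>_def)
qed

lemma delta_eq:
  assumes "1 \<le> t" "s \<in> {1..S t}"
  shows "\<delta> t s = (e t + (real s - 1)) / \<Gamma> t"
  using params_1[of s] params[of t s] Gamma_pos[of t] assms
  by (cases "t = 1") (auto simp: e_def field_simps)

lemma gamma_eq: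
  assumes "1 \<le> t" "s \<in> {1..S t}"
  shows "sz_gamma P t s = 4 / \<alpha> * (M t)\<^sup>2 * \<Gamma> t / \<delta> t s"
  using params_1[of s] params[of t s] assms by (cases "t = 1") auto

lemma beta_eq:
  assumes "1 \<le> t" "1 \<le> s" "Suc s \<le> S t"
  shows "\<beta> t (Suc s) = \<alpha> / 4 * (\<Gamma> t * \<delta> t s)"
proof -
  have "\<Gamma> t * \<delta> t s = e t + real s - 1"
    using assms delta_eq[of t s] Gamma_pos[of t] by auto
  moreover have "\<beta> t (Suc s) = \<alpha> / 4 * (e t + real s - 1)"
    using params_1[of "Suc s"] params[of t "Suc s"] assms
    by (cases "t = 1") (auto simp: e_def mult.commute)
  ultimately show ?thesis by simp
qed

lemma beta_first: "2 \<le> t \<Longrightarrow> 1 \<le> S t \<Longrightarrow> \<beta> t 1 = \<alpha> / 4 * (\<Gamma> t * \<delta> t 1)"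
  using params[of t 1] by simp

lemma beta_initial: "1 \<le> S 1 \<Longrightarrow> \<beta> 1 1 = 0"
  using params_1[of 1] by simp

text \<open>The sums are unbounded in \<open>k\<close>, so the number of inner iterations is well-defined. The hypothesis on \<open>c\<close>
allows the use of this fact in the proof that \<open>W\<close> is positive.\<close>

lemma inner_spec:
  assumes t: "1 \<le> t" and c: "0 \<le> c t"
  shows "1 \<le> S t" "D t \<le> real (S t) * c t + real (S t) * (real (S t) - 1) / 2"
proof -
  obtain k :: nat where k: "2 * D t + 1 < real k" using reals_Archimedean2 by blast
  have "1 * (2 * D t) \<le> real k * (real k - 1)"
    using k D_pos[OF t] by (intro mult_mono) auto
  moreover have "0 \<le> real k * c t" using c by simp
  ultimately have "1 \<le> k \<and> D t \<le> real k * c t + real k * (real k - 1) / 2"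
    using k D_pos[OF t] by auto
  then have "1 \<le> S t \<and> D t \<le> real (S t) * c t + real (S t) * (real (S t) - 1) / 2"
    unfolding inner_Least[OF t] by (rule LeastI)
  then show "1 \<le> S t" "D t \<le> real (S t) * c t + real (S t) * (real (S t) - 1) / 2" by auto
qed

lemma W_pos: "2 \<le> t \<Longrightarrow> 0 < W t"
proof (induction t rule: dec_induct)
  case base
  have "1 \<le> S 1" by (rule inner_spec) (auto simp: c_def)
  then have "0 < W (Suc 1)"
    using W[of 1] delta_eq[of 1 "S 1"] Gamma_pos[of 1] M_pos[of 1] by (simp add: e_def)
  then show ?case by simp
next
  case (step t)
  have "1 \<le> S t" using step M_pos[of t] by (intro inner_spec) (auto simp: c_def)
  then show "0 < W (Suc t)"
    using step W[of t] delta_eq[of t "S t"] Gamma_pos[of t] M_pos[of t]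
    by (auto simp: e_def add_pos_nonneg)
qed

lemma c_pos: "1 \<le> t \<Longrightarrow> 0 < c t"
  using W_pos[of t] M_pos[of t] by (auto simp: c_def)

lemma e_pos: "1 \<le> t \<Longrightarrow> 0 < e t"
  using W_pos[of t] M_pos[of t] Gamma_pos[of t] by (auto simp: e_def)

lemma inner_ge_1: "1 \<le> t \<Longrightarrow> 1 \<le> S t"
  using inner_spec(1)[of t] c_pos[of t] by simp

text \<open>If \<open>\<Gamma> t\<close> were below 1, the left-hand side of \<open>Gamma_eq\<close> would be at least \<open>\<Gamma> t\<close> times the sum that
reaches \<open>D t\<close>. Then \<open>(\<Gamma> t)\<^sup>2 * D t\<close> would be at least \<open>\<Gamma> t * D t\<close>.\<close>

lemma Gamma_ge_1:
  assumes t: "1 \<le> t"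
  shows "1 \<le> \<Gamma> t"
proof (rule ccontr)
  assume "\<not> 1 \<le> \<Gamma> t"
  then have G: "\<Gamma> t < 1" by simp
  have "\<Gamma> t * (c t * real (S t)) \<le> e t * real (S t)"
    using G Gamma_pos[OF t] by (auto simp: e_def c_def mult_left_le_one_le)
  moreover have "\<Gamma> t * (real (S t) * (real (S t) - 1) / 2) \<le> 1 * (real (S t) * (real (S t) - 1) / 2)"
    using G inner_ge_1[OF t] by (intro mult_right_mono) auto
  ultimately have "\<Gamma> t * (real (S t) * c t + real (S t) * (real (S t) - 1) / 2)
      \<le> (\<Gamma> t)\<^sup>2 * D t"
    unfolding Gamma_eq[OF t, symmetric] by (simp add: distrib_left mult.commute mult.left_commute)
  moreover have "\<Gamma> t * D t \<le> \<Gamma> t * (real (S t) * c t + real (S t) * (real (S t) - 1) / 2)"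
    using inner_spec(2)[OF t] c_pos[OF t] Gamma_pos[OF t] by (intro mult_left_mono) auto
  ultimately have "\<Gamma> t * D t * 1 \<le> \<Gamma> t * D t * \<Gamma> t" by (simp add: power2_eq_square algebra_simps)
  then show False
    using G D_pos[OF t] Gamma_pos[OF t] mult_le_cancel_left_pos[of "\<Gamma> t * D t" 1 "\<Gamma> t"] by simp
qed

lemma delta_pos: "1 \<le> t \<Longrightarrow> s \<in> {1..S t} \<Longrightarrow> 0 < \<delta> t s"
  using e_pos[of t] Gamma_pos[of t] by (auto simp: delta_eq add_pos_nonneg)

lemma delta_mono: "1 \<le> t \<Longrightarrow> 1 \<le> s \<Longrightarrow> Suc s \<le> S t \<Longrightarrow> \<delta> t s \<le> \<delta> t (Suc s)"
  using Gamma_pos[of t] by (auto simp: delta_eq intro!: divide_right_mono)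

lemma sum_delta:
  assumes t: "1 \<le> t"
  shows "(\<Sum>s=1..S t. \<delta> t s) = \<Gamma> t * D t"
proof -
  have "(\<Sum>s=1..S t. \<delta> t s) = (\<Sum>s=1..S t. e t + (real s - 1)) / \<Gamma> t"
    unfolding sum_divide_distrib using t by (intro sum.cong) (auto simp: delta_eq)
  also have "\<dots> = \<Gamma> t * D t"
    unfolding sum_arith_progression Gamma_eq[OF t] using Gamma_pos[OF t] by (simp add: power2_eq_square)
  finally show ?thesis .
qed

lemma weight_eq:
  assumes t: "1 \<le> t"
  shows "w t s = \<delta> t s / (\<Gamma> t * (M t)\<^sup>2 * \<Delta>)"
  using omega_ge_1[OF t] Gamma_pos[OF t] M_pos[of t] Delta_pos
  unfolding inner_weight_def sum_delta[OF t] by (simp add: D_def field_simps)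

lemma weight_pos: "1 \<le> t \<Longrightarrow> s \<in> {1..S t} \<Longrightarrow> 0 < w t s"
  using delta_pos[of t s] Gamma_pos[of t] M_pos[of t] Delta_pos by (simp add: weight_eq)

lemma sum_weight:
  assumes "1 \<le> t"
  shows "(\<Sum>s=1..S t. w t s) = \<omega> t"
  using Gamma_pos[OF assms] D_pos[OF assms] sum_delta[OF assms]
  by (simp add: inner_weight_def flip: sum_divide_distrib sum_distrib_left)

lemma weight_gamma:
  assumes "1 \<le> t" "s \<in> {1..S t}"
  shows "w t s * sz_gamma P t s = 2 * K"
  using delta_pos[OF assms] Gamma_pos[OF assms(1)] M_pos[of t] Delta_pos alpha_pos
  unfolding weight_eq[OF assms(1)] gamma_eq[OF assms] by (simp add: K_def field_simps)

text \<open>Half of the strong convexity compensates the increase of \<open>\<beta>\<close>: as \<open>\<Gamma> t * \<delta> t s\<close> grows by 1 in each inner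
iteration, the left-hand side is \<open>\<alpha> / 4 * \<Gamma> t\<close> times the next value of \<open>\<delta>\<close>.\<close>

lemma beta_lower:
  assumes "1 \<le> t" "s \<in> {1..S t}"
  shows "\<alpha> / 4 * (\<Gamma> t * \<delta> t s + 1) \<le> \<beta> t s + \<alpha> / 2"
proof (cases "s = 1")
  case True
  show ?thesis
  proof (cases "t = 1")
    case True
    then show ?thesis using beta_initial assms \<open>s = 1\<close> Gamma_pos[of 1] alpha_pos
      by (simp add: delta_eq e_def)
  next
    case False
    then show ?thesis using beta_first[of t] assms \<open>s = 1\<close> alpha_pos by (simp add: field_simps)
  qed
next
  case False
  then obtain r where r: "s = Suc r" "1 \<le> r" using assms(2) by (cases s) auto
  have "\<Gamma> t * \<delta> t r = e t + real r - 1"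
    using r assms delta_eq[of t r] Gamma_pos[of t] by auto
  then have "\<beta> t s + \<alpha> / 2 = \<alpha> / 4 * (e t + real s)"
    using assms r by (simp add: beta_eq distrib_left right_diff_distrib add_divide_distrib)
  then show ?thesis using assms Gamma_pos[of t] delta_eq[of t s] by (simp add: field_simps)
qed

lemma beta_nonneg: "1 \<le> t \<Longrightarrow> s \<in> {1..S t} \<Longrightarrow> 0 \<le> \<beta> t s"
proof -
  assume ts: "1 \<le> t" "s \<in> {1..S t}"
  consider "s = 1" "t = 1" | "s = 1" "2 \<le> t" | r where "s = Suc r" "1 \<le> r"
    using ts by (cases s; cases "s = 1"; cases "t = 1") auto
  then show ?thesis
  proof cases
    case 1 then show ?thesis using beta_initial ts by simp
  next
    case 2
    then have "0 \<le> \<alpha> / 4 * (\<Gamma> t * \<delta> t 1)"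
      using ts delta_pos[of t 1] Gamma_pos[of t] alpha_pos by simp
    then show ?thesis using beta_first[of t] ts 2 by simp
  next
    case 3
    then have "0 \<le> \<alpha> / 4 * (\<Gamma> t * \<delta> t r)"
      using ts delta_pos[of t r] Gamma_pos[of t] alpha_pos by simp
    then show ?thesis using beta_eq[of t r] ts 3 by simp
  qed
qed

text \<open>The hypothesis of Young's inequality that makes the potential nonnegative.\<close>

lemma weight_sq_le:
  assumes "1 \<le> t" "s \<in> {1..S t}"
  shows "(w t s * M t)\<^sup>2 \<le> 2 * K * (w t s * (\<beta> t s + \<alpha> / 2))"
proof -
  have G: "1 \<le> \<Gamma> t" using Gamma_ge_1 assms by simp
  have d: "0 < \<delta> t s" using delta_pos assms by simp
  have "(w t s * M t)\<^sup>2 = w t s * (\<delta> t s / (\<Gamma> t * \<Delta>))"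
    using M_pos[of t] assms by (simp add: weight_eq power2_eq_square)
  also have "\<delta> t s / (\<Gamma> t * \<Delta>) \<le> \<delta> t s * \<Gamma> t / \<Delta>"
    using G d Delta_pos mult_mono[of 1 "\<Gamma> t" 1 "\<Gamma> t"] by (simp add: field_simps)
  also have "\<dots> = 2 * K * (\<alpha> / 4 * (\<Gamma> t * \<delta> t s))"
    using alpha_pos by (simp add: K_def)
  also have "\<dots> \<le> 2 * K * (\<beta> t s + \<alpha> / 2)"
    using beta_lower[OF assms] K_pos alpha_pos by (intro mult_left_mono) (auto simp: distrib_left)
  finally show ?thesis using weight_pos[OF assms] by (simp add: mult_left_mono mult.left_commute)
qed

text \<open>The coefficients of the squared distance to the solution telescope within a phase.\<close>

lemma weight_beta_mono:
  assumes "1 \<le> t" "1 \<le> s" "Suc s \<le> S t"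
  shows "w t (Suc s) * \<beta> t (Suc s) \<le> w t s * (\<beta> t s + \<alpha> / 2)"
proof -
  have "w t (Suc s) * \<beta> t (Suc s) = w t s * (\<alpha> / 4 * (\<Gamma> t * \<delta> t (Suc s)))"
    using assms by (simp add: weight_eq beta_eq)
  also have "\<alpha> / 4 * (\<Gamma> t * \<delta> t (Suc s)) = \<alpha> / 4 * (\<Gamma> t * \<delta> t s + 1)"
    using assms Gamma_pos[of t] by (auto simp: delta_eq of_nat_diff field_simps)
  also have "\<dots> \<le> \<beta> t s + \<alpha> / 2"
    using assms by (intro beta_lower) auto
  finally show ?thesis using weight_pos[of t s] assms by (simp add: mult_left_mono)
qed

text \<open>The hypothesis of Young's inequality for the error of the extrapolation within a phase.\<close>

lemma weight_sq_le_beta: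
  assumes "1 \<le> t" "1 \<le> s" "Suc s \<le> S t"
  shows "(w t s * M t)\<^sup>2 \<le> 2 * K * (w t (Suc s) * \<beta> t (Suc s))"
proof -
  have G: "1 \<le> \<Gamma> t" using Gamma_ge_1 assms by simp
  have d: "0 < \<delta> t s" using delta_pos assms by simp
  have "(w t s * M t)\<^sup>2 = w t s * (\<delta> t s / (\<Gamma> t * \<Delta>))"
    using M_pos[of t] assms by (simp add: weight_eq power2_eq_square)
  also have "\<dots> \<le> w t (Suc s) * (\<delta> t s * \<Gamma> t / \<Delta>)"
  proof (rule mult_mono)
    show "w t s \<le> w t (Suc s)"
      using delta_mono[OF assms] G Delta_pos assms by (simp add: weight_eq divide_right_mono)
    show "\<delta> t s / (\<Gamma> t * \<Delta>) \<le> \<delta> t s * \<Gamma> t / \<Delta>"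
      using G d Delta_pos mult_mono[of 1 "\<Gamma> t" 1 "\<Gamma> t"] by (simp add: field_simps)
  qed (use weight_pos[of t "Suc s"] assms G d Delta_pos in auto)
  also have "\<dots> = 2 * K * (w t (Suc s) * \<beta> t (Suc s))"
    using alpha_pos assms by (simp add: K_def beta_eq)
  finally show ?thesis .
qed

text \<open>The analogues of the last two estimates when a new phase starts. The matrix changes with the phase, and
\<open>W\<close> is defined such that \<open>M\<close> drops out: divided by \<open>M\<close>, the last \<open>\<delta>\<close> of one phase and the first \<open>\<delta>\<close> of
the next one are both equal to \<open>W (Suc t)\<close>. So the product of the new phase is
\<open>\<alpha> / 4 * (W (Suc t))\<^sup>2 / \<Delta>\<close>. The first estimate holds because of \<open>\<Gamma> t \<ge> 1\<close>, the second one by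
\<open>beta_lower\<close>.\<close>

lemma phase_change:
  assumes "1 \<le> t"
  shows "(w t (S t) * M t)\<^sup>2 \<le> 2 * K * (w (Suc t) 1 * \<beta> (Suc t) 1)"
    and "w (Suc t) 1 * \<beta> (Suc t) 1 \<le> w t (S t) * (\<beta> t (S t) + \<alpha> / 2)"
proof -
  have S: "S t \<in> {1..S t}" "1 \<in> {1..S (Suc t)}"
    using inner_ge_1 assms inner_ge_1[of "Suc t"] by auto
  have G: "1 \<le> \<Gamma> t" "0 < \<Gamma> (Suc t)" using Gamma_ge_1 Gamma_pos assms by auto
  have d: "\<delta> t (S t) = W (Suc t) * M t" using W[OF assms] M_pos[of t] by simp
  have d': "\<delta> (Suc t) 1 = W (Suc t) * M (Suc t)"
    using delta_eq[of "Suc t" 1] S G assms by (simp add: e_def)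
  have new: "w (Suc t) 1 * \<beta> (Suc t) 1 = \<alpha> / 4 * ((W (Suc t))\<^sup>2 / \<Delta>)"
  proof -
    have b: "\<beta> (Suc t) 1 = \<alpha> / 4 * (\<Gamma> (Suc t) * \<delta> (Suc t) 1)"
      using beta_first[of "Suc t"] S assms by simp
    have w: "w (Suc t) 1 = \<delta> (Suc t) 1 / (\<Gamma> (Suc t) * (M (Suc t))\<^sup>2 * \<Delta>)"
      by (rule weight_eq) simp
    show ?thesis
      unfolding b w d' using G(2) M_pos[of "Suc t"] by (simp add: power2_eq_square mult_ac)
  qed
  have w: "w t (S t) = W (Suc t) / (\<Gamma> t * M t * \<Delta>)"
    using M_pos[of t] unfolding weight_eq[OF assms] d by (simp add: power2_eq_square)
  have "(w t (S t) * M t)\<^sup>2 = (W (Suc t) / \<Delta>)\<^sup>2 / (\<Gamma> t)\<^sup>2"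
    unfolding w using M_pos[of t] by (simp add: power_divide power_mult_distrib)
  also have "\<dots> \<le> (W (Suc t) / \<Delta>)\<^sup>2"
    using G(1) divide_left_mono[of 1 "(\<Gamma> t)\<^sup>2" "(W (Suc t) / \<Delta>)\<^sup>2"] by simp
  also have "\<dots> = 2 * K * (w (Suc t) 1 * \<beta> (Suc t) 1)"
    unfolding new using alpha_pos by (simp add: K_def power2_eq_square)
  finally show "(w t (S t) * M t)\<^sup>2 \<le> 2 * K * (w (Suc t) 1 * \<beta> (Suc t) 1)" .
  have "w (Suc t) 1 * \<beta> (Suc t) 1 = w t (S t) * (\<alpha> / 4 * (\<Gamma> t * \<delta> t (S t)))"
    unfolding new unfolding w d using G(1) M_pos[of t] by (simp add: power2_eq_square mult_ac)
  also have "\<dots> \<le> w t (S t) * (\<beta> t (S t) + \<alpha> / 2)"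
    using beta_lower[OF assms S(1)] weight_pos[OF assms S(1)] alpha_pos
    by (intro mult_left_mono) (auto simp: distrib_left)
  finally show "w (Suc t) 1 * \<beta> (Suc t) 1 \<le> w t (S t) * (\<beta> t (S t) + \<alpha> / 2)" .
qed

lemma weight_rho:
  assumes "1 \<le> t" "1 \<le> s" "Suc s \<le> S t"
  shows "w t (Suc s) * sz_rho P t (Suc s) = w t s"
  using delta_pos[of t "Suc s"] assms by (simp add: rho weight_eq)

lemma weight_rho_1:
  assumes "2 \<le> t"
  shows "w t 1 * sz_rho P t 1 = w (t - 1) (S (t - 1))"
  using weight_pos[of t 1] inner_ge_1[of t] assms by (simp add: rho_1)

section \<open>The number of inner iterations\<close>

lemma W_Suc: "1 \<le> t \<Longrightarrow> W (Suc t) = (e t + (real (S t) - 1)) / (\<Gamma> t * M t)"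
  using W[of t] delta_eq[of t "S t"] inner_ge_1[of t] by simp

lemma W_eq: "2 \<le> t \<Longrightarrow> W t = e t / (\<Gamma> t * M t)"
  using Gamma_pos[of t] M_pos[of t] by (simp add: e_def)

text \<open>In a phase \<open>t \<ge> 2\<close> the summands \<open>\<delta> t s\<close> form an arithmetic progression from \<open>W t * M t\<close> to \<open>W (Suc t) * M t\<close>, so the
equation for \<open>\<Gamma> t\<close> expresses \<open>\<Delta> * \<omega> t\<close> through a product of difference and sum of the two values of
\<open>W\<close>. Hence the square of \<open>W\<close> grows by at most \<open>2 * \<Delta> * \<omega> t\<close> in each phase.\<close>

lemma W_sq_le: "1 \<le> N \<Longrightarrow> (W (Suc N))\<^sup>2 \<le> 2 * \<Delta> * A N"
proof (induction N rule: dec_induct)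
  case base
  have "(real (S 1))\<^sup>2 \<le> 2 * ((\<Gamma> 1)\<^sup>2 * D 1)"
    using Gamma_eq[of 1] by (simp add: e_def power2_eq_square field_simps)
  moreover have "W (Suc 1) = real (S 1) / (\<Gamma> 1 * M 1)" using W_Suc[of 1] by (simp add: e_def)
  ultimately show ?case
    using Gamma_pos[of 1] M_pos[of 1] omega_1
    by (simp add: A_def D_def power_divide power_mult_distrib divide_le_eq mult_ac)
next
  case (step N)
  define t where "t = Suc N"
  have t: "2 \<le> t" "1 \<le> t" using step by (auto simp: t_def)
  have pos: "0 < \<Gamma> t" "0 < M t" "0 < e t" "1 \<le> real (S t)"
    using Gamma_pos M_pos e_pos inner_ge_1[of t] t by auto
  have "(W (Suc t))\<^sup>2 - (W t)\<^sup>2 = (real (S t) - 1) * (2 * e t + real (S t) - 1) / (\<Gamma> t * M t)\<^sup>2"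
    unfolding W_Suc[OF t(2)] W_eq[OF t(1)] power_divide diff_divide_distrib[symmetric]
    by (simp add: power2_eq_square algebra_simps)
  also have "\<dots> \<le> real (S t) * (2 * e t + real (S t) - 1) / (\<Gamma> t * M t)\<^sup>2"
    using pos by (intro divide_right_mono mult_right_mono) auto
  also have "real (S t) * (2 * e t + real (S t) - 1) = 2 * ((\<Gamma> t)\<^sup>2 * D t)"
    unfolding Gamma_eq[OF t(2), symmetric] by (simp add: field_simps)
  also have "\<dots> / (\<Gamma> t * M t)\<^sup>2 = 2 * \<Delta> * \<omega> t"
    using pos by (simp add: D_def power_mult_distrib)
  finally have "(W (Suc t))\<^sup>2 \<le> (W t)\<^sup>2 + 2 * \<Delta> * \<omega> t" by simp
  then show ?case using step by (simp add: t_def A_Suc distrib_left)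
qed

lemma inner_minimal:
  assumes t: "1 \<le> t" and S: "2 \<le> S t"
  shows "(real (S t) - 1) * c t + (real (S t) - 1) * (real (S t) - 2) / 2 < D t"
proof (rule ccontr)
  assume "\<not> ?thesis"
  then have "1 \<le> S t - 1 \<and> D t \<le> real (S t - 1) * c t + real (S t - 1) * (real (S t - 1) - 1) / 2"
    using S by (simp add: of_nat_diff algebra_simps)
  then have "S t \<le> S t - 1"
    by (subst inner_Least[OF t]) (rule Least_le)
  then show False using S by simp
qed

text \<open>For three or more inner iterations, minimality of \<open>S t\<close> bounds the equation for \<open>\<Gamma> t\<close> from above: passing
from \<open>S t - 1\<close> to \<open>S t\<close> iterations at most triples the sum, so \<open>\<Gamma> t < 3\<close>. Phases with one or two
iterations are covered by the summand 2.\<close>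

lemma inner_le:
  assumes t: "2 \<le> t"
  shows "real (S t) \<le> 2 + 3 * M t * (W (Suc t) - W t)" and "W t \<le> W (Suc t)"
proof -
  have t1: "1 \<le> t" using t by simp
  have pos: "0 < \<Gamma> t" "0 < M t" "0 < c t" "1 \<le> real (S t)"
    using Gamma_pos M_pos c_pos inner_ge_1[of t] t by auto
  have eq: "real (S t) - 1 = \<Gamma> t * (M t * (W (Suc t) - W t))"
    unfolding W_Suc[OF t1] W_eq[OF t] using pos by (simp add: field_simps)
  then have "0 \<le> \<Gamma> t * (M t * (W (Suc t) - W t))" using pos by simp
  then show mono: "W t \<le> W (Suc t)" using pos by (simp add: zero_le_mult_iff)
  show "real (S t) \<le> 2 + 3 * M t * (W (Suc t) - W t)"
  proof (cases "S t \<le> 2")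
    case True
    then have "real (S t) \<le> 2" by simp
    moreover have "0 \<le> 3 * M t * (W (Suc t) - W t)" using mono pos by simp
    ultimately show ?thesis by linarith
  next
    case False
    define n where "n = real (S t)"
    have n: "3 \<le> n" using False by (simp add: n_def)
    have e: "e t = \<Gamma> t * c t" using t by (simp add: e_def c_def)
    have "n * (n - 1) / 2 \<le> 3 * ((n - 1) * (n - 2) / 2)"
    proof -
      have "0 \<le> (n - 1) * (n - 3)" using n by simp
      then show ?thesis by (simp add: field_simps)
    qed
    moreover have "n * c t \<le> 3 * ((n - 1) * c t)"
    proof -
      have "n * c t \<le> (3 * (n - 1)) * c t" using n pos by (intro mult_right_mono) auto
      then show ?thesis by (simp only: mult.assoc)
    qed
    moreover have "(n - 1) * c t + (n - 1) * (n - 2) / 2 < D t"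
      using inner_minimal[OF t1] False by (simp add: n_def)
    ultimately have "n * c t + n * (n - 1) / 2 < 3 * D t" by linarith
    then have "\<Gamma> t * (n * c t + n * (n - 1) / 2) < \<Gamma> t * (3 * D t)" using pos by simp
    moreover have "(\<Gamma> t)\<^sup>2 * D t \<le> \<Gamma> t * (n * c t + n * (n - 1) / 2)"
    proof -
      have "1 * (n * (n - 1) / 2) \<le> \<Gamma> t * (n * (n - 1) / 2)"
        using Gamma_ge_1[OF t1] n by (intro mult_right_mono) auto
      then show ?thesis
        unfolding Gamma_eq[OF t1, symmetric] e n_def[symmetric] by (simp add: algebra_simps)
    qed
    ultimately have "\<Gamma> t * D t * \<Gamma> t < \<Gamma> t * D t * 3" by (simp add: power2_eq_square algebra_simps)
    then have G: "\<Gamma> t < 3"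
      using pos D_pos[OF t1] mult_less_cancel_left_pos[of "\<Gamma> t * D t" "\<Gamma> t" 3] by simp
    have "real (S t) - 1 \<le> 3 * (M t * (W (Suc t) - W t))"
      unfolding eq using G mono pos by (intro mult_right_mono) auto
    then show ?thesis by simp
  qed
qed

text \<open>In phase 1 there is no preceding value of \<open>W\<close>, and minimality of \<open>S 1\<close> is used directly.\<close>

lemma inner_1_le: "real (S 1) \<le> 1 + M 1 * sqrt (2 * \<Delta>)"
proof (cases "S 1 = 1")
  case True
  then show ?thesis using M_pos[of 1] Delta_pos by simp
next
  case False
  then have S: "2 \<le> S 1" using inner_ge_1[of 1] by simp
  then have "(real (S 1) - 1) * real (S 1) < 2 * D 1"
    using inner_minimal[of 1] by (simp add: c_def field_simps)
  moreover have "(real (S 1) - 1)\<^sup>2 \<le> (real (S 1) - 1) * real (S 1)"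
    using S by (simp add: power2_eq_square mult_left_mono)
  ultimately have "(real (S 1) - 1)\<^sup>2 \<le> (M 1 * sqrt (2 * \<Delta>))\<^sup>2"
    using omega_1 Delta_pos by (simp add: D_def power_mult_distrib mult_ac)
  then have "real (S 1) - 1 \<le> M 1 * sqrt (2 * \<Delta>)"
    by (rule power2_le_imp_le) (use M_pos[of 1] Delta_pos in simp)
  then show ?thesis by simp
qed

lemma sum_inner_le:
  assumes N: "1 \<le> N" and B: "\<And>t. 1 \<le> t \<Longrightarrow> M t \<le> B"
  shows "(\<Sum>t=1..N. real (S t)) \<le> 2 * real N + B * (sqrt (2 * \<Delta>) + 3 * sqrt (2 * \<Delta> * A N))"
proof -
  have B0: "0 < B" using B[of 1] M_pos[of 1] by simp
  have "(\<Sum>t=1..n. real (S t)) \<le> 2 * real n + B * (sqrt (2 * \<Delta>) + 3 * W (Suc n))" if "1 \<le> n" for n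
    using that
  proof (induction n rule: dec_induct)
    case base
    have "real (S 1) \<le> 1 + B * sqrt (2 * \<Delta>)"
    proof -
      have "M 1 * sqrt (2 * \<Delta>) \<le> B * sqrt (2 * \<Delta>)"
        using B[of 1] Delta_pos by (intro mult_right_mono) auto
      with inner_1_le show ?thesis by linarith
    qed
    moreover have "0 \<le> B * (3 * W (Suc 1))" using B0 W_pos[of "Suc 1"] by simp
    ultimately show ?case by (simp add: distrib_left)
  next
    case (step n)
    have t: "2 \<le> Suc n" using step by simp
    have "M (Suc n) * (W (Suc (Suc n)) - W (Suc n)) \<le> B * (W (Suc (Suc n)) - W (Suc n))"
      using B[of "Suc n"] inner_le(2)[OF t] by (intro mult_right_mono) auto
    with inner_le(1)[OF t] have "real (S (Suc n)) \<le> 2 + 3 * (B * (W (Suc (Suc n)) - W (Suc n)))"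
      by simp
    then show ?case using step by (simp add: algebra_simps)
  qed
  from this[OF N] have "(\<Sum>t=1..N. real (S t)) \<le> 2 * real N + B * (sqrt (2 * \<Delta>) + 3 * W (Suc N))" .
  also have "\<dots> \<le> 2 * real N + B * (sqrt (2 * \<Delta>) + 3 * sqrt (2 * \<Delta> * A N))"
    using real_le_rsqrt[OF W_sq_le[OF N]] B0 by (simp add: mult_left_mono)
  finally show ?thesis .
qed

end

section \<open>One primal-dual step\<close>

lemma young_weighted:
  fixes a b p s t :: real
  assumes "p\<^sup>2 \<le> 4 * a * b" "0 \<le> a" "0 \<le> b"
  shows "p * s * t \<le> a * s\<^sup>2 + b * t\<^sup>2"
proof -
  have "(p * s * t)\<^sup>2 = p\<^sup>2 * (s\<^sup>2 * t\<^sup>2)" by (simp add: power_mult_distrib)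
  also have "\<dots> \<le> 4 * a * b * (s\<^sup>2 * t\<^sup>2)" using assms(1) by (intro mult_right_mono) auto
  also have "\<dots> = (a * s\<^sup>2 + b * t\<^sup>2)\<^sup>2 - (a * s\<^sup>2 - b * t\<^sup>2)\<^sup>2"
    by (simp add: power2_eq_square algebra_simps)
  also have "\<dots> \<le> (a * s\<^sup>2 + b * t\<^sup>2)\<^sup>2" by simp
  finally show ?thesis
    using assms(2,3) by (intro power2_le_imp_le[of "p * s * t"]) auto
qed

lemma bilinear_young:
  fixes l :: "real^'m" and N :: "real^'n^'m"
  assumes "norm (N *v v) \<le> M * norm v" "(w * M)\<^sup>2 \<le> 4 * a * b" "0 \<le> a" "0 \<le> b" "0 \<le> w"
  shows "\<bar>w * (l \<bullet> (N *v v))\<bar> \<le> a * (norm l)\<^sup>2 + b * (norm v)\<^sup>2"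
proof -
  have "\<bar>l \<bullet> (N *v v)\<bar> \<le> norm l * norm (N *v v)" by (rule Cauchy_Schwarz_ineq2)
  also have "\<dots> \<le> norm l * (M * norm v)" using assms(1) by (rule mult_left_mono) simp
  finally have "w * \<bar>l \<bullet> (N *v v)\<bar> \<le> w * (norm l * (M * norm v))"
    using assms(5) by (rule mult_left_mono)
  also have "\<dots> = w * M * norm l * norm v" by simp
  also have "\<dots> \<le> a * (norm l)\<^sup>2 + b * (norm v)\<^sup>2"
    by (rule young_weighted) (use assms in auto)
  finally show ?thesis using assms(5) by (simp add: abs_mult)
qed

text \<open>The index-free form of one inner iteration. Here \<open>h\<close> is the momentum, \<open>lm\<close>, \<open>l0\<close>, \<open>l1\<close> are consecutive
multipliers, \<open>N'\<close> and \<open>N\<close> the Jacobians of the previous and the current iteration, which differ at the start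
of a phase, and \<open>w'\<close>, \<open>w\<close> their weights. The extrapolation in \<open>h\<close> replaces \<open>l1\<close>, unknown when \<open>y1\<close> is
computed. The error of this replacement is a difference of two consecutive cross terms, which telescopes,
plus a product of \<open>l0 - lm\<close> and \<open>y1 - y0\<close>, which the proximal terms absorb by Young's inequality. Of the
modulus \<open>\<alpha>\<close> one half goes to the coefficient of the potential and one half to that of \<open>\<eta>\<close>.\<close>

lemma primal_dual_step:
  fixes N N' :: "real^'n^'m" and y0 y1 z a b p h :: "real^'n" and l l0 l1 lm g0 :: "real^'m"
  assumes primal: "(h + p) \<bullet> (y1 - z) + u1 - uz \<le>
        \<eta> / 2 * ((norm (a - z))\<^sup>2 - (norm (y1 - a))\<^sup>2 - (norm (y1 - z))\<^sup>2)
      + \<beta> / 2 * ((norm (y0 - z))\<^sup>2 - (norm (y1 - y0))\<^sup>2 - (norm (y1 - z))\<^sup>2)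
      - \<alpha> / 2 * (norm (y1 - z))\<^sup>2"
    and dual: "(l - l1) \<bullet> (N *v (y1 - b) + g0)
        \<le> \<gamma> / 2 * ((norm (l - l0))\<^sup>2 - (norm (l1 - l0))\<^sup>2 - (norm (l - l1))\<^sup>2)"
    and h: "\<And>v. w * (h \<bullet> v) = w * (l0 \<bullet> (N *v v)) + w' * ((l0 - lm) \<bullet> (N' *v v))"
    and N': "norm (N' *v (y1 - y0)) \<le> M' * norm (y1 - y0)"
    and pos: "0 \<le> w" "0 \<le> w'" "0 \<le> \<beta>" "0 \<le> K"
    and w: "w * \<gamma> = 2 * K" "(w' * M')\<^sup>2 \<le> 2 * K * (w * \<beta>)" "w * \<beta> / 2 \<le> B'"
  shows "w * (p \<bullet> (y1 - z) + u1 - uz + l \<bullet> (N *v (y1 - b) + g0) - l1 \<bullet> (N *v (z - b) + g0)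
          + \<eta> / 2 * (norm (y1 - a))\<^sup>2 + (\<eta> + \<alpha> / 2) / 2 * (norm (y1 - z))\<^sup>2)
      + (w * (\<beta> + \<alpha> / 2) / 2 * (norm (y1 - z))\<^sup>2 + K * (norm (l - l1))\<^sup>2
          - w * ((l1 - l0) \<bullet> (N *v (y1 - z))) + K * (norm (l1 - l0))\<^sup>2)
    \<le> w * (\<eta> / 2 * (norm (a - z))\<^sup>2)
      + (B' * (norm (y0 - z))\<^sup>2 + K * (norm (l - l0))\<^sup>2
          - w' * ((l0 - lm) \<bullet> (N' *v (y0 - z))) + K * (norm (l0 - lm))\<^sup>2)"
proof -
  have P: "w * ((h + p) \<bullet> (y1 - z) + u1 - uz) \<le> w * (
        \<eta> / 2 * ((norm (a - z))\<^sup>2 - (norm (y1 - a))\<^sup>2 - (norm (y1 - z))\<^sup>2)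
      + \<beta> / 2 * ((norm (y0 - z))\<^sup>2 - (norm (y1 - y0))\<^sup>2 - (norm (y1 - z))\<^sup>2)
      - \<alpha> / 2 * (norm (y1 - z))\<^sup>2)"
    using primal pos(1) by (rule mult_left_mono)
  have "w * ((l - l1) \<bullet> (N *v (y1 - b) + g0))
        \<le> w * (\<gamma> / 2 * ((norm (l - l0))\<^sup>2 - (norm (l1 - l0))\<^sup>2 - (norm (l - l1))\<^sup>2))"
    using dual pos(1) by (rule mult_left_mono)
  also have "\<dots> = K * ((norm (l - l0))\<^sup>2 - (norm (l1 - l0))\<^sup>2 - (norm (l - l1))\<^sup>2)"
    using w(1) by (simp flip: mult.assoc)
  finally have Q: "w * ((l - l1) \<bullet> (N *v (y1 - b) + g0))
      \<le> K * ((norm (l - l0))\<^sup>2 - (norm (l1 - l0))\<^sup>2 - (norm (l - l1))\<^sup>2)" .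
  have "\<bar>w' * ((l0 - lm) \<bullet> (N' *v (y1 - y0)))\<bar>
      \<le> K * (norm (l0 - lm))\<^sup>2 + w * \<beta> / 2 * (norm (y1 - y0))\<^sup>2"
    by (rule bilinear_young[OF N']) (use pos w in \<open>auto simp: mult_ac\<close>)
  then have Y: "- (w' * ((l0 - lm) \<bullet> (N' *v (y1 - y0))))
      \<le> K * (norm (l0 - lm))\<^sup>2 + w * \<beta> / 2 * (norm (y1 - y0))\<^sup>2" by linarith
  have B: "w * \<beta> / 2 * (norm (y0 - z))\<^sup>2 \<le> B' * (norm (y0 - z))\<^sup>2"
    using w(3) by (rule mult_right_mono) simp
  \<comment> \<open>passing from \<open>y1 - z\<close> to \<open>y0 - z\<close> turns the second term into the cross term of the preceding step\<close>
  have H: "w * (h \<bullet> (y1 - z)) = w * (l0 \<bullet> (N *v (y1 - z)))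
      + w' * ((l0 - lm) \<bullet> (N' *v (y1 - y0))) + w' * ((l0 - lm) \<bullet> (N' *v (y0 - z)))"
  proof -
    have "N' *v (y1 - z) = N' *v (y1 - y0) + N' *v (y0 - z)"
      by (simp flip: matrix_vector_right_distrib)
    then show ?thesis unfolding h by (simp add: inner_add_right distrib_left)
  qed
  have G: "l \<bullet> (N *v (y1 - b) + g0) - l1 \<bullet> (N *v (z - b) + g0)
      = (l - l1) \<bullet> (N *v (y1 - b) + g0) + l0 \<bullet> (N *v (y1 - z)) + (l1 - l0) \<bullet> (N *v (y1 - z))"
  proof -
    have "N *v (y1 - z) = N *v (y1 - b) - N *v (z - b)"
      by (simp flip: matrix_vector_mult_diff_distrib)
    then show ?thesis by (simp add: inner_add_right inner_diff_left inner_diff_right)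
  qed
  have G': "w * (p \<bullet> (y1 - z) + u1 - uz + l \<bullet> (N *v (y1 - b) + g0) - l1 \<bullet> (N *v (z - b) + g0)
          + \<eta> / 2 * (norm (y1 - a))\<^sup>2 + (\<eta> + \<alpha> / 2) / 2 * (norm (y1 - z))\<^sup>2)
     = w * (p \<bullet> (y1 - z) + u1 - uz) + w * ((l - l1) \<bullet> (N *v (y1 - b) + g0))
          + w * (l0 \<bullet> (N *v (y1 - z))) + w * ((l1 - l0) \<bullet> (N *v (y1 - z)))
          + w * (\<eta> / 2 * (norm (y1 - a))\<^sup>2) + w * ((\<eta> + \<alpha> / 2) / 2 * (norm (y1 - z))\<^sup>2)"
    using G by (simp only: distrib_left[symmetric]) (simp add: algebra_simps)
  show ?thesis
    using P Q Y B H unfolding G'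
    by (simp add: inner_add_left distrib_left right_diff_distrib add_divide_distrib diff_divide_distrib
        distrib_right left_diff_distrib mult_ac)
qed

section \<open>A run of the method\<close>

text \<open>A run on a problem with a KKT pair. The constant \<open>L\<close> of the stepsize rule enters through the smoothness of
the Lagrangian with the optimal multiplier.\<close>

locale acgd_run =
  fixes X :: "(real^'n) set" and f u :: "real^'n \<Rightarrow> real" and g :: "real^'n \<Rightarrow> real^'m"
    and \<alpha> L :: real and x0 xs :: "real^'n" and ls :: "real^'m"
    and P :: stepsizes and Z :: "('n, 'm) iterates" and \<Gamma> W :: "nat \<Rightarrow> real"
  assumes f_convex: "convex_on UNIV f" and f_diff: "\<And>x. f differentiable (at x)"
    and g_convex: "\<And>i. convex_on UNIV (\<lambda>x. g x $ i)" and g_diff: "\<And>x. g differentiable (at x)"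
    and u_sc: "strongly_convex_on X \<alpha> u"
    and kkt: "kkt_pair X f g u xs ls"
    and smooth: "L-lipschitz_on UNIV (gradient (\<lambda>x. f x + ls \<bullet> g x))"
    and x0: "x0 \<noteq> xs"
    and run: "acgd_s X f g u x0 P Z"
    and stepsizes: "sc_stepsizes \<alpha> L ((norm ls + 1) / norm (x0 - xs)) (phase_norm g Z) P \<Gamma> W"
begin

sublocale sc_stepsizes \<alpha> L "(norm ls + 1) / norm (x0 - xs)" "phase_norm g Z" P \<Gamma> W
  by (rule stepsizes)

abbreviation "x \<equiv> it_x Z"
abbreviation "xu \<equiv> it_xu Z"
abbreviation "y \<equiv> it_y Z"
abbreviation "lam \<equiv> it_lam Z"
abbreviation "xbar \<equiv> acgd_output P Z"
abbreviation "\<nu> t \<equiv> jac g (xu t)"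
abbreviation "M \<equiv> phase_norm g Z"

definition F :: "real^'n \<Rightarrow> real" where "F v = f v + ls \<bullet> g v"

text \<open>The Lagrangian with multiplier \<open>l\<close>, linearised at $\underline x^t$: with \<open>u\<close> and the
proximal term added, the inner iterations of phase \<open>t\<close> approximate its saddle point.\<close>

definition lin :: "nat \<Rightarrow> real^'n \<Rightarrow> real^'m \<Rightarrow> real" where
  "lin t v l = f (xu t) + gradient f (xu t) \<bullet> (v - xu t) + l \<bullet> (\<nu> t *v (v - xu t) + g (xu t))"

lemma xs_X: "xs \<in> X" and g_xs: "g xs $ i \<le> 0" and ls_orthant: "ls \<in> orthant"
  using kkt by (auto simp: kkt_pair_def is_arg_min_def)

lemma convex_X: "convex X" using u_sc by (simp add: strongly_convex_on_def)

lemma ls_g_xs: "ls \<bullet> g xs = 0"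
  unfolding inner_vec_def inner_real_def using kkt by (intro sum.neutral) (auto simp: kkt_pair_def)

lemma lagrangian_tangent:
  assumes "l \<in> orthant"
  shows "f v + gradient f v \<bullet> (z - v) + l \<bullet> (jac g v *v (z - v) + g v) \<le> f z + l \<bullet> g z"
proof -
  have "convex_on UNIV (\<lambda>x. \<Sum>i\<in>I. l $ i * g x $ i)" if "finite I" for I
    using that
  proof (induction I rule: finite_induct)
    case (insert i I)
    then show ?case
      using assms g_convex by (simp add: convex_on_add convex_on_cmul orthant_def)
  qed (simp add: convex_on_const)
  then have "convex_on UNIV (\<lambda>x. l \<bullet> g x)"
    by (simp add: inner_vec_def)
  then have "convex_on UNIV (\<lambda>x. f x + l \<bullet> g x)"
    using f_convex by (rule convex_on_add[rotated])
  from tangent_le_of_convex_on[OF this gradient_lagrangian[OF f_diff g_diff], of v z]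
  show ?thesis by (simp add: inner_add_right)
qed

lemma lin_le: "l \<in> orthant \<Longrightarrow> lin t v l \<le> f v + l \<bullet> g v"
  unfolding lin_def by (rule lagrangian_tangent)

lemma lin_xs_le: "l \<in> orthant \<Longrightarrow> lin t xs l \<le> f xs"
proof -
  assume l: "l \<in> orthant"
  have "l \<bullet> g xs \<le> 0"
    unfolding inner_vec_def inner_real_def using l g_xs
    by (intro sum_nonpos mult_nonneg_nonpos) (auto simp: orthant_def)
  with lin_le[OF l, of t xs] show ?thesis by simp
qed

lemma gradient_F: "gradient F v \<bullet> h = gradient f v \<bullet> h + ls \<bullet> (jac g v *v h)"
  and F_diff: "F differentiable (at v)"
proof -
  have *: "(F has_derivative (\<lambda>h. gradient f v \<bullet> h + ls \<bullet> (jac g v *v h))) (at v)"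
    using gradient_lagrangian[OF f_diff g_diff] unfolding F_def[abs_def] .
  then show d: "F differentiable (at v)" by (auto simp: differentiable_def)
  show "gradient F v \<bullet> h = gradient f v \<bullet> h + ls \<bullet> (jac g v *v h)"
    using has_derivative_unique[OF has_derivative_gradient[OF d] *] by metis
qed

lemma lin_ls: "lin t v ls = F (xu t) + gradient F (xu t) \<bullet> (v - xu t)"
  by (simp add: lin_def gradient_F F_def inner_add_right)

lemma F_upper: "F z \<le> F v + gradient F v \<bullet> (z - v) + L / 2 * (norm (z - v))\<^sup>2"
  using F_diff smooth unfolding F_def[abs_def, symmetric]
  by (rule quadratic_upper_bound_of_lipschitz_gradient)

lemma F_lower: "F v + gradient F v \<bullet> (z - v) \<le> F z"
  using lagrangian_tangent[OF ls_orthant, of v z] by (simp add: gradient_F F_def inner_add_right)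

text \<open>Add the tangent inequality of \<open>F\<close> at \<open>xs\<close>, the strongly convex subgradient inequality of \<open>u\<close>, and the
normal cone condition. By complementarity \<open>F xs = f xs\<close>.\<close>

lemma kkt_growth:
  assumes v: "v \<in> X"
  shows "f xs + u xs + \<alpha> / 2 * (norm (v - xs))\<^sup>2 \<le> F v + u v"
proof -
  obtain u' where u': "u' \<in> subdifferential X u xs"
    and n: "- (gradient f xs + (\<Sum>i\<in>UNIV. ls $ i *\<^sub>R gradient (\<lambda>x. g x $ i) xs) + u')
          \<in> normal_cone X xs"
    using kkt by (auto simp: kkt_pair_def)
  have "(\<Sum>i\<in>UNIV. ls $ i *\<^sub>R gradient (\<lambda>x. g x $ i) xs) \<bullet> (v - xs) = ls \<bullet> (jac g xs *v (v - xs))"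
    by (simp add: inner_sum_left gradient_component[OF g_diff] inner_vec_def[of ls])
  then have "0 \<le> gradient F xs \<bullet> (v - xs) + u' \<bullet> (v - xs)"
    using n v by (auto simp: normal_cone_def inner_add_left inner_diff_left gradient_F)
  moreover have "u xs + u' \<bullet> (v - xs) + \<alpha> / 2 * (norm (v - xs))\<^sup>2 \<le> u v"
    using strongly_convex_on_subgradient[OF u_sc u' xs_X v] .
  moreover have "f xs + gradient F xs \<bullet> (v - xs) \<le> F v"
    using F_lower[of xs v] ls_g_xs by (simp add: F_def)
  ultimately show ?thesis by linarith
qed

lemma run_init: "x0 \<in> X" "x 0 = x0" "xu 0 = x0" "y 1 0 = x0" "lam 1 0 = 0" "it_lam_prev Z 1 = 0"
  using run by (auto simp: acgd_s_def)

lemma run_xu: "1 \<le> t \<Longrightarrow> xu t = (1 / (1 + \<tau> t)) *\<^sub>R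
    (\<tau> t *\<^sub>R xu (t - 1) + (x (t - 1) + sz_theta P t *\<^sub>R (x (t - 1) - x (t - 2))))"
  using run unfolding acgd_s_def by blast

lemma run_y: "1 \<le> t \<Longrightarrow> s \<in> {1..S t} \<Longrightarrow> is_arg_min
    (\<lambda>v. (momentum g P Z t s + gradient f (xu t)) \<bullet> v + u v
        + \<eta> t / 2 * (norm (v - x (t - 1)))\<^sup>2 + \<beta> t s / 2 * (norm (v - y t (s - 1)))\<^sup>2)
    (\<lambda>v. v \<in> X) (y t s)"
  using run unfolding acgd_s_def by blast

lemma run_lam: "1 \<le> t \<Longrightarrow> s \<in> {1..S t} \<Longrightarrow> is_arg_max
    (\<lambda>l. l \<bullet> (\<nu> t *v (y t s - xu t) + g (xu t)) - sz_gamma P t s / 2 * (norm (l - lam t (s - 1)))\<^sup>2)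
    (\<lambda>l. l \<in> orthant) (lam t s)"
  using run unfolding acgd_s_def by blast

lemma run_next: "1 \<le> t \<Longrightarrow> lam (Suc t) 0 = lam t (S t)"
    "1 \<le> t \<Longrightarrow> it_lam_prev Z (Suc t) = lam t (S t - 1)"
    "1 \<le> t \<Longrightarrow> y (Suc t) 0 = y t (S t)"
    "1 \<le> t \<Longrightarrow> x t = (1 / (\<Sum>s=1..S t. \<delta> t s)) *\<^sub>R (\<Sum>s=1..S t. \<delta> t s *\<^sub>R y t s)"
  using run unfolding acgd_s_def Suc_eq_plus1 by blast+

lemma y_X: "1 \<le> t \<Longrightarrow> s \<in> {1..S t} \<Longrightarrow> y t s \<in> X"
  using run_y by (simp add: is_arg_min_def)

lemma lam_orthant: "1 \<le> t \<Longrightarrow> s \<in> {1..S t} \<Longrightarrow> lam t s \<in> orthant"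
  using run_lam by (simp add: is_arg_max_def)

lemma x_average: "1 \<le> t \<Longrightarrow> x t = (\<Sum>s=1..S t. (w t s / \<omega> t) *\<^sub>R y t s)"
  using omega_ge_1[of t] by (simp add: run_next(4) inner_weight_def scaleR_sum_right)

lemma x_X: "x t \<in> X"
proof (cases "t = 0")
  case False
  then have t: "1 \<le> t" by simp
  have "(\<Sum>s=1..S t. (w t s / \<omega> t) *\<^sub>R y t s) \<in> X"
  proof (rule convex_sum[OF _ convex_X])
    show "(\<Sum>s=1..S t. w t s / \<omega> t) = 1"
      using sum_weight[OF t] omega_ge_1[OF t] by (simp flip: sum_divide_distrib)
    show "0 \<le> w t s / \<omega> t" if "s \<in> {1..S t}" for s
      using weight_pos[OF t that] omega_ge_1[OF t] by simp
  qed (use y_X t in auto)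
  then show ?thesis using x_average[OF t] by simp
qed (use run_init in simp)

lemma matrix_bound: "norm (\<nu> t *v v) \<le> M t * norm v"
proof -
  have "norm (\<nu> t *v v) \<le> matrix_norm (\<nu> t) * norm v"
    unfolding matrix_norm_def by (rule onorm) (rule matrix_vector_mul_bounded_linear)
  also have "\<dots> \<le> M t * norm v"
    by (intro mult_right_mono) (auto simp: phase_norm_def Let_def)
  finally show ?thesis .
qed

section \<open>The inner loop\<close>

text \<open>The potential after inner iteration \<open>s\<close> of phase \<open>t\<close>. Besides the squared distances to the KKT pair it
contains the pending cross term of the extrapolation, which the first and the last term dominate.\<close>

definition \<Phi> :: "nat \<Rightarrow> nat \<Rightarrow> real" where
  "\<Phi> t s = w t s * (\<beta> t s + \<alpha> / 2) / 2 * (norm (y t s - xs))\<^sup>2 + K * (norm (ls - lam t s))\<^sup>2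
     - w t s * ((lam t s - lam t (s - 1)) \<bullet> (\<nu> t *v (y t s - xs)))
     + K * (norm (lam t s - lam t (s - 1)))\<^sup>2"

text \<open>The potential at the start of a phase. In phase 1 only the distance of the multipliers is left,
because \<open>\<beta> 1 1 = 0\<close> and both initial multipliers vanish.\<close>

definition \<Phi>\<^sub>0 :: "nat \<Rightarrow> real" where
  "\<Phi>\<^sub>0 t = (if t = 1 then K * (norm ls)\<^sup>2 else \<Phi> (t - 1) (S (t - 1)))"

text \<open>The gap of the linearised Lagrangian at \<open>v\<close>, with the proximal terms of the outer loop.\<close>

definition T :: "nat \<Rightarrow> real^'n \<Rightarrow> real" where
  "T t v = lin t v ls + u v - f xs - u xs + \<eta> t / 2 * (norm (v - x (t - 1)))\<^sup>2
     + (\<eta> t + \<alpha> / 2) / 2 * (norm (v - xs))\<^sup>2"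

lemma Phi_nonneg:
  assumes "1 \<le> t" "s \<in> {1..S t}"
  shows "0 \<le> \<Phi> t s"
proof -
  have "0 \<le> \<beta> t s + \<alpha> / 2" using beta_nonneg[OF assms] alpha_pos by simp
  then have B: "0 \<le> w t s * (\<beta> t s + \<alpha> / 2) / 2" using weight_pos[OF assms] by simp
  have "\<bar>w t s * ((lam t s - lam t (s - 1)) \<bullet> (\<nu> t *v (y t s - xs)))\<bar>
      \<le> K * (norm (lam t s - lam t (s - 1)))\<^sup>2
        + w t s * (\<beta> t s + \<alpha> / 2) / 2 * (norm (y t s - xs))\<^sup>2"
    by (rule bilinear_young[OF matrix_bound])
       (use weight_sq_le[OF assms] weight_pos[OF assms] B K_pos in \<open>auto simp: mult_ac\<close>)
  moreover have "0 \<le> K * (norm (ls - lam t s))\<^sup>2" using K_pos by simp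
  ultimately show ?thesis unfolding \<Phi>_def by linarith
qed

text \<open>The gap compares \<open>y t s\<close> with \<open>xs\<close> at two different multipliers. At \<open>xs\<close> the multiplier \<open>lam t s\<close> can be
dropped, since linearisations of the Lagrangian are below \<open>f xs\<close> there by convexity and feasibility.\<close>

lemma inner_step:
  assumes t: "1 \<le> t" "s \<in> {1..S t}"
    and h: "\<And>v. w t s * (momentum g P Z t s \<bullet> v) =
      w t s * (lam t (s - 1) \<bullet> (\<nu> t *v v)) + w' * ((lam t (s - 1) - lm) \<bullet> (\<nu> t' *v v))"
    and w': "0 \<le> w'" "(w' * M t')\<^sup>2 \<le> 2 * K * (w t s * \<beta> t s)" "w t s * \<beta> t s \<le> B"
  shows "w t s * T t (y t s) + \<Phi> t s \<le> w t s * (\<eta> t / 2 * (norm (x (t - 1) - xs))\<^sup>2)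
      + (B / 2 * (norm (y t (s - 1) - xs))\<^sup>2 + K * (norm (ls - lam t (s - 1)))\<^sup>2
          - w' * ((lam t (s - 1) - lm) \<bullet> (\<nu> t' *v (y t (s - 1) - xs)))
          + K * (norm (lam t (s - 1) - lm))\<^sup>2)"
proof -
  have pos: "0 \<le> w t s" "0 \<le> \<beta> t s" "0 \<le> K" "w t s * \<beta> t s / 2 \<le> B / 2"
    using weight_pos[OF t] beta_nonneg[OF t] K_pos w'(3) by auto
  note step = primal_dual_step[OF prox_step[OF u_sc xs_X run_y[OF t]]
      dual_prox_step[OF ls_orthant run_lam[OF t]] h matrix_bound
      pos(1) w'(1) pos(2,3) weight_gamma[OF t] w'(2) pos(4)]
  have "lin t xs (lam t s) \<le> f xs" using lin_xs_le lam_orthant t by simp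
  then have "T t (y t s) \<le> gradient f (xu t) \<bullet> (y t s - xs) + u (y t s) - u xs
      + ls \<bullet> (\<nu> t *v (y t s - xu t) + g (xu t)) - lam t s \<bullet> (\<nu> t *v (xs - xu t) + g (xu t))
      + \<eta> t / 2 * (norm (y t s - x (t - 1)))\<^sup>2 + (\<eta> t + \<alpha> / 2) / 2 * (norm (y t s - xs))\<^sup>2"
    unfolding T_def lin_def by (simp add: inner_diff_right)
  from mult_left_mono[OF this pos(1)] step show ?thesis
    unfolding \<Phi>_def by linarith
qed

lemma momentum_first:
  "momentum g P Z t 1 \<bullet> v = lam t 0 \<bullet> (\<nu> t *v v)
     + sz_rho P t 1 * ((lam t 0 - it_lam_prev Z t) \<bullet> (\<nu> (t - 1) *v v))"
  by (simp add: momentum_def inner_add_left dot_lmul_matrix)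

lemma momentum_later:
  "s \<noteq> 1 \<Longrightarrow> momentum g P Z t s \<bullet> v = lam t (s - 1) \<bullet> (\<nu> t *v v)
     + sz_rho P t s * ((lam t (s - 1) - lam t (s - 2)) \<bullet> (\<nu> t *v v))"
  by (simp add: momentum_def inner_add_left dot_lmul_matrix)

lemma first_inner_step:
  assumes t: "1 \<le> t"
  shows "w t 1 * T t (y t 1) + \<Phi> t 1 \<le> w t 1 * (\<eta> t / 2 * (norm (x (t - 1) - xs))\<^sup>2) + \<Phi>\<^sub>0 t"
proof (cases "t = 1")
  case True
  have S: "1 \<in> {1..S 1}" using inner_ge_1[of 1] by simp
  have "w 1 1 * T 1 (y 1 1) + \<Phi> 1 1 \<le> w 1 1 * (\<eta> 1 / 2 * (norm (x (1 - 1) - xs))\<^sup>2)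
      + (0 / 2 * (norm (y 1 (1 - 1) - xs))\<^sup>2 + K * (norm (ls - lam 1 (1 - 1)))\<^sup>2
          - 0 * ((lam 1 (1 - 1) - 0) \<bullet> (\<nu> 0 *v (y 1 (1 - 1) - xs)))
          + K * (norm (lam 1 (1 - 1) - 0))\<^sup>2)"
    by (rule inner_step) (use S beta_initial run_init in \<open>auto simp: momentum_first\<close>)
  then show ?thesis using True run_init by (simp add: \<Phi>\<^sub>0_def)
next
  case False
  define r where "r = t - 1"
  have r: "1 \<le> r" "t = Suc r" "2 \<le> t" using t False by (auto simp: r_def)
  have S: "1 \<in> {1..S t}" "S r \<in> {1..S r}" using inner_ge_1[of t] inner_ge_1[of r] t r by auto
  have "w t 1 * T t (y t 1) + \<Phi> t 1 \<le> w t 1 * (\<eta> t / 2 * (norm (x (t - 1) - xs))\<^sup>2)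
      + (w r (S r) * (\<beta> r (S r) + \<alpha> / 2) / 2 * (norm (y t (1 - 1) - xs))\<^sup>2
          + K * (norm (ls - lam t (1 - 1)))\<^sup>2
          - w r (S r) * ((lam t (1 - 1) - it_lam_prev Z t) \<bullet> (\<nu> r *v (y t (1 - 1) - xs)))
          + K * (norm (lam t (1 - 1) - it_lam_prev Z t))\<^sup>2)"
  proof (rule inner_step[OF t S(1)])
    show "w t 1 * (momentum g P Z t 1 \<bullet> v) = w t 1 * (lam t (1 - 1) \<bullet> (\<nu> t *v v))
        + w r (S r) * ((lam t (1 - 1) - it_lam_prev Z t) \<bullet> (\<nu> r *v v))" for v
      unfolding momentum_first weight_rho_1[OF r(3), folded r_def, symmetric]
      by (simp add: distrib_left r_def)
    show "0 \<le> w r (S r)" using weight_pos[OF r(1) S(2)] by simp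
    show "(w r (S r) * M r)\<^sup>2 \<le> 2 * K * (w t 1 * \<beta> t 1)"
      "w t 1 * \<beta> t 1 \<le> w r (S r) * (\<beta> r (S r) + \<alpha> / 2)"
      using phase_change[OF r(1)] r(2) by auto
  qed
  moreover have "lam t 0 = lam r (S r)" "it_lam_prev Z t = lam r (S r - 1)" "y t 0 = y r (S r)"
    using run_next(1-3)[OF r(1)] r(2) by auto
  ultimately show ?thesis using False by (simp add: \<Phi>\<^sub>0_def \<Phi>_def flip: r_def)
qed

lemma later_inner_step:
  assumes t: "1 \<le> t" "1 \<le> s" "Suc s \<le> S t"
  shows "w t (Suc s) * T t (y t (Suc s)) + \<Phi> t (Suc s)
    \<le> w t (Suc s) * (\<eta> t / 2 * (norm (x (t - 1) - xs))\<^sup>2) + \<Phi> t s"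
proof -
  have "w t (Suc s) * T t (y t (Suc s)) + \<Phi> t (Suc s)
    \<le> w t (Suc s) * (\<eta> t / 2 * (norm (x (t - 1) - xs))\<^sup>2)
      + (w t s * (\<beta> t s + \<alpha> / 2) / 2 * (norm (y t (Suc s - 1) - xs))\<^sup>2
          + K * (norm (ls - lam t (Suc s - 1)))\<^sup>2
          - w t s * ((lam t (Suc s - 1) - lam t (s - 1)) \<bullet> (\<nu> t *v (y t (Suc s - 1) - xs)))
          + K * (norm (lam t (Suc s - 1) - lam t (s - 1)))\<^sup>2)"
  proof (rule inner_step)
    show "w t (Suc s) * (momentum g P Z t (Suc s) \<bullet> v) = w t (Suc s) * (lam t (Suc s - 1) \<bullet> (\<nu> t *v v))
        + w t s * ((lam t (Suc s - 1) - lam t (s - 1)) \<bullet> (\<nu> t *v v))" for v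
    proof -
      have "Suc s \<noteq> 1" "Suc s - 2 = s - 1" using t by auto
      then show ?thesis
        unfolding weight_rho[OF t, symmetric] by (simp add: momentum_later distrib_left)
    qed
  qed (use t weight_pos[of t s] weight_sq_le_beta[OF t] weight_beta_mono[OF t] in auto)
  then show ?thesis by (simp add: \<Phi>_def)
qed

lemma sum_inner_steps:
  assumes t: "1 \<le> t" and s: "1 \<le> s" "s \<le> S t"
  shows "(\<Sum>r=1..s. w t r * T t (y t r)) + \<Phi> t s
    \<le> (\<Sum>r=1..s. w t r) * (\<eta> t / 2 * (norm (x (t - 1) - xs))\<^sup>2) + \<Phi>\<^sub>0 t"
  using s
proof (induction s rule: dec_induct)
  case base
  then show ?case using first_inner_step[OF t] by simp
next
  case (step s)
  then show ?case using later_inner_step[OF t, of s] by (simp add: distrib_right add_divide_distrib)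
qed

lemma convex_T:
  assumes "1 \<le> t"
  shows "convex_on X (T t)"
proof -
  define p where "p = gradient F (xu t)"
  define c where "c = F (xu t) - p \<bullet> xu t - f xs - u xs"
  have "strongly_convex_on X (\<alpha> + \<eta> t + (\<eta> t + \<alpha> / 2))
      (\<lambda>v. 0 \<bullet> v + (p \<bullet> v + u v + \<eta> t / 2 * (norm (v - x (t - 1)))\<^sup>2)
        + (\<eta> t + \<alpha> / 2) / 2 * (norm (v - xs))\<^sup>2)" (is "strongly_convex_on X _ ?h")
    by (intro strongly_convex_on_prox u_sc)
  then have "convex_on X ?h"
    by (rule strongly_convex_on_imp_convex_on) (use eta_pos[OF assms] alpha_pos in simp)
  then have "convex_on X (\<lambda>v. ?h v + c)"
    by (rule convex_on_add) (simp add: convex_on_const convex_X)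
  moreover have "T t = (\<lambda>v. ?h v + c)"
    by (rule ext) (simp add: T_def lin_ls c_def p_def inner_diff_right)
  ultimately show ?thesis by simp
qed

text \<open>Jensen's inequality for \<open>T t\<close> replaces the weighted inner iterates by their average \<open>x t\<close>.\<close>

lemma phase_inequality:
  assumes t: "1 \<le> t"
  shows "\<omega> t * T t (x t) + \<Phi> t (S t) \<le> \<omega> t * (\<eta> t / 2 * (norm (x (t - 1) - xs))\<^sup>2) + \<Phi>\<^sub>0 t"
proof -
  have om: "0 < \<omega> t" using omega_ge_1[OF t] by simp
  have "T t (\<Sum>s=1..S t. (w t s / \<omega> t) *\<^sub>R y t s) \<le> (\<Sum>s=1..S t. w t s / \<omega> t * T t (y t s))"
  proof (rule convex_on_sum[OF _ _ convex_T[OF t]])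
    show "{1..S t} \<noteq> {}" using inner_ge_1[OF t] by simp
    show "(\<Sum>s=1..S t. w t s / \<omega> t) = 1"
      using sum_weight[OF t] om by (simp flip: sum_divide_distrib)
    show "0 \<le> w t s / \<omega> t" if "s \<in> {1..S t}" for s
      using weight_pos[OF t that] om by simp
  qed (use y_X t in auto)
  then have "\<omega> t * T t (x t) \<le> (\<Sum>s=1..S t. w t s * T t (y t s))"
    using om by (simp add: x_average[OF t] pos_le_divide_eq mult.commute flip: sum_divide_distrib)
  moreover have "(\<Sum>s=1..S t. w t s * T t (y t s)) + \<Phi> t (S t)
      \<le> \<omega> t * (\<eta> t / 2 * (norm (x (t - 1) - xs))\<^sup>2) + \<Phi>\<^sub>0 t"
    using sum_inner_steps[OF t _ order_refl] inner_ge_1[OF t] sum_weight[OF t] by simp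
  ultimately show ?thesis by linarith
qed

section \<open>The outer loop\<close>

lemma A_xbar: "A N *\<^sub>R xbar N = (\<Sum>t=1..N. \<omega> t *\<^sub>R x t)"
  using A_ge_1[of N] by (cases "N = 0") (auto simp: acgd_output_def A_def)

text \<open>The extrapolation terms \<open>\<omega> (t - 1) * (x (t - 1) - x (t - 2))\<close> exchange each \<open>x (t - 2)\<close> in the running
weighted sum for \<open>x (t - 1)\<close>. So $\underline x^t$ is the point of Nesterov's method.\<close>

lemma A_xu: "A (Suc n) *\<^sub>R xu (Suc n) = A n *\<^sub>R xbar n + \<omega> (Suc n) *\<^sub>R x n"
proof (induction n)
  case 0
  show ?case
    unfolding One_nat_def[symmetric]
    using run_xu[of 1] tau_1 theta[of 1] omega_1 run_init by (simp add: A_def)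
next
  case (Suc n)
  let ?t = "Suc (Suc n)"
  have pos: "0 \<le> \<tau> ?t" by (rule tau_nonneg) simp
  then have "A ?t *\<^sub>R xu ?t = \<omega> ?t *\<^sub>R ((1 + \<tau> ?t) *\<^sub>R xu ?t)"
    by (simp add: A_eq)
  also have "(1 + \<tau> ?t) *\<^sub>R xu ?t
      = \<tau> ?t *\<^sub>R xu (Suc n) + (x (Suc n) + sz_theta P ?t *\<^sub>R (x (Suc n) - x n))"
    using run_xu[of ?t] pos by simp
  also have "\<omega> ?t *\<^sub>R \<dots> = A (Suc n) *\<^sub>R xu (Suc n) + \<omega> ?t *\<^sub>R x (Suc n)
      + (\<omega> ?t * sz_theta P ?t) *\<^sub>R (x (Suc n) - x n)"
    by (simp add: A_eq_Suc[of "Suc n"] scaleR_add_right)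
  also have "\<omega> ?t * sz_theta P ?t = \<omega> (Suc n)"
    using omega_theta[of ?t] by simp
  also have "A (Suc n) *\<^sub>R xu (Suc n) + \<omega> ?t *\<^sub>R x (Suc n) + \<omega> (Suc n) *\<^sub>R (x (Suc n) - x n)
      = A (Suc n) *\<^sub>R xbar (Suc n) + \<omega> ?t *\<^sub>R x (Suc n)"
    unfolding Suc A_xbar by (simp add: scaleR_diff_right)
  finally show ?case .
qed

text \<open>The usual step of accelerated gradient methods: \<open>xbar t - xu t\<close> is \<open>x t - x (t - 1)\<close> divided by
\<open>1 + \<tau> t\<close>, so the quadratic term of the smoothness bound is at most the proximal term with \<open>\<eta> t\<close>. The
linear part splits into the linearisations at the old average and at \<open>x t\<close>.\<close>

lemma accelerated_descent:
  "A (Suc n) * F (xbar (Suc n)) \<le> A n * F (xbar n) + \<omega> (Suc n) * lin (Suc n) (x (Suc n)) ls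
     + \<omega> (Suc n) * (\<eta> (Suc n) / 2 * (norm (x (Suc n) - x n))\<^sup>2)"
proof -
  define t where "t = Suc n"
  define p where "p = gradient F (xu t)"
  have t: "1 \<le> t" by (simp add: t_def)
  have om: "0 < \<omega> t" and A: "0 < A t" and tau: "0 < 1 + \<tau> t"
    using omega_ge_1[OF t] A_ge_1[OF t] tau_nonneg[OF t] by auto
  have xu: "A t *\<^sub>R xu t = A n *\<^sub>R xbar n + \<omega> t *\<^sub>R x n"
    unfolding t_def by (rule A_xu)
  have xbar: "A t *\<^sub>R xbar t = A n *\<^sub>R xbar n + \<omega> t *\<^sub>R x t"
    by (simp add: A_xbar t_def)
  have "A t *\<^sub>R (xbar t - xu t) = \<omega> t *\<^sub>R (x t - x n)"
    by (simp add: scaleR_diff_right xu xbar)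
  then have "A t * norm (xbar t - xu t) = \<omega> t * norm (x t - x n)"
    using A om by (metis abs_of_pos norm_scaleR)
  then have "\<omega> t * ((1 + \<tau> t) * norm (xbar t - xu t)) = \<omega> t * norm (x t - x n)"
    by (simp add: A_eq[OF t])
  then have "norm (xbar t - xu t) = norm (x t - x n) / (1 + \<tau> t)"
    using om tau by (subst (asm) mult_left_cancel) (auto simp: field_simps)
  then have "A t * (L / 2 * (norm (xbar t - xu t))\<^sup>2)
      = \<omega> t * (L / (1 + \<tau> t) / 2 * (norm (x t - x n))\<^sup>2)"
    using tau by (simp add: A_eq[OF t] power2_eq_square)
  also have "\<dots> \<le> \<omega> t * (\<eta> t / 2 * (norm (x t - x n))\<^sup>2)"
    using eta_ge[OF t] om by (intro mult_left_mono mult_right_mono divide_right_mono) auto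
  finally have quad: "A t * (L / 2 * (norm (xbar t - xu t))\<^sup>2)
      \<le> \<omega> t * (\<eta> t / 2 * (norm (x t - x n))\<^sup>2)" .
  have "A t * F (xbar t)
      \<le> A t * (F (xu t) + p \<bullet> (xbar t - xu t) + L / 2 * (norm (xbar t - xu t))\<^sup>2)"
    using F_upper[of "xbar t" "xu t"] A by (simp add: p_def)
  also have "\<dots> = A t * F (xu t) + p \<bullet> (A t *\<^sub>R xbar t) - p \<bullet> (A t *\<^sub>R xu t)
      + A t * (L / 2 * (norm (xbar t - xu t))\<^sup>2)"
    by (simp add: inner_diff_right algebra_simps)
  finally have 1: "A t * F (xbar t) \<le> A t * F (xu t) + p \<bullet> (A t *\<^sub>R xbar t) - p \<bullet> (A t *\<^sub>R xu t)
      + A t * (L / 2 * (norm (xbar t - xu t))\<^sup>2)" .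
  have An: "0 \<le> A n" using A_ge_1[of n] by (cases "n = 0") (auto simp: A_def)
  have "A n * (F (xu t) + p \<bullet> (xbar n - xu t)) \<le> A n * F (xbar n)"
    using F_lower[of "xu t" "xbar n"] An by (simp add: p_def mult_left_mono)
  then have 2: "A n * F (xu t) + p \<bullet> (A n *\<^sub>R xbar n) - A n * (p \<bullet> xu t) \<le> A n * F (xbar n)"
    by (simp add: inner_diff_right algebra_simps)
  have 3: "\<omega> t * lin t (x t) ls = \<omega> t * F (xu t) + \<omega> t * (p \<bullet> x t) - \<omega> t * (p \<bullet> xu t)"
    by (simp add: lin_ls p_def inner_diff_right algebra_simps)
  have At: "A t = A n + \<omega> t" by (simp add: t_def A_Suc)
  have 4: "p \<bullet> (A t *\<^sub>R xu t) = A n * (p \<bullet> xu t) + \<omega> t * (p \<bullet> xu t)"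
    "p \<bullet> (A t *\<^sub>R xbar t) = p \<bullet> (A n *\<^sub>R xbar n) + \<omega> t * (p \<bullet> x t)"
    "A t * F (xu t) = A n * F (xu t) + \<omega> t * F (xu t)"
    unfolding xbar by (simp_all add: At inner_add_right distrib_right)
  show ?thesis
    unfolding t_def[symmetric] using 1 2 3 4 quad by linarith
qed

text \<open>Sum of \<open>accelerated_descent\<close> and \<open>phase_inequality\<close> over all phases. The linearisations cancel, the
potentials \<open>\<Phi>\<close> telescope, and \<open>outer_weights\<close> makes the distances of \<open>x t\<close> to \<open>xs\<close> telescope.\<close>

lemma energy_bound:
  assumes "1 \<le> N"
  shows "A N * F (xbar N) + (\<Sum>t=1..N. \<omega> t * u (x t)) - A N * (f xs + u xs)
      + \<omega> N * ((\<eta> N + \<alpha> / 2) / 2 * (norm (x N - xs))\<^sup>2) + \<Phi> N (S N)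
    \<le> \<eta> 1 / 2 * (norm (x0 - xs))\<^sup>2 + K * (norm ls)\<^sup>2"
  using assms
proof (induction N rule: dec_induct)
  case base
  have "\<omega> 1 * T 1 (x 1) + \<Phi> 1 (S 1) \<le> \<omega> 1 * (\<eta> 1 / 2 * (norm (x0 - xs))\<^sup>2) + \<Phi>\<^sub>0 1"
    using phase_inequality[of 1] run_init by simp
  moreover have "A 1 * F (xbar 1) \<le> \<omega> 1 * lin 1 (x 1) ls + \<omega> 1 * (\<eta> 1 / 2 * (norm (x 1 - x 0))\<^sup>2)"
    using accelerated_descent[of 0] unfolding One_nat_def[symmetric] by (simp add: A_def)
  ultimately show ?case
    using omega_1 by (simp add: T_def \<Phi>\<^sub>0_def A_def)
next
  case (step N)
  define t where "t = Suc N"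
  have t: "1 \<le> t" and N: "1 \<le> N" using step by (auto simp: t_def)
  have P: "\<omega> t * T t (x t) + \<Phi> t (S t) \<le> \<omega> t * \<eta> t * (1 / 2 * (norm (x N - xs))\<^sup>2) + \<Phi> N (S N)"
    using phase_inequality[OF t] N by (simp add: t_def \<Phi>\<^sub>0_def)
  have D: "A t * F (xbar t) \<le> A N * F (xbar N) + \<omega> t * lin t (x t) ls
     + \<omega> t * (\<eta> t / 2 * (norm (x t - x N))\<^sup>2)"
    unfolding t_def by (rule accelerated_descent)
  have O: "\<omega> t * \<eta> t * (1 / 2 * (norm (x N - xs))\<^sup>2)
      \<le> \<omega> N * (\<eta> N + \<alpha> / 2) * (1 / 2 * (norm (x N - xs))\<^sup>2)"
    unfolding t_def by (rule mult_right_mono[OF outer_weights[OF N]]) simp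
  have T: "\<omega> t * T t (x t) = \<omega> t * lin t (x t) ls + \<omega> t * u (x t) - \<omega> t * (f xs + u xs)
      + \<omega> t * (\<eta> t / 2 * (norm (x t - x N))\<^sup>2) + \<omega> t * ((\<eta> t + \<alpha> / 2) / 2 * (norm (x t - xs))\<^sup>2)"
  proof -
    have "t - 1 = N" by (simp add: t_def)
    then show ?thesis unfolding T_def by (simp only: distrib_left right_diff_distrib)
  qed
  have A: "A t * (f xs + u xs) = A N * (f xs + u xs) + \<omega> t * (f xs + u xs)"
    by (simp add: t_def A_Suc distrib_right)
  have S: "(\<Sum>r=1..t. \<omega> r * u (x r)) = (\<Sum>r=1..N. \<omega> r * u (x r)) + \<omega> t * u (x t)"
    by (simp add: t_def)
  have O': "\<omega> N * (\<eta> N + \<alpha> / 2) * (1 / 2 * (norm (x N - xs))\<^sup>2)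
      = \<omega> N * ((\<eta> N + \<alpha> / 2) / 2 * (norm (x N - xs))\<^sup>2)" by simp
  show ?case
    unfolding t_def[symmetric] A S using step.IH P[unfolded T] D O O' by linarith
qed

lemma xbar_average: "1 \<le> N \<Longrightarrow> xbar N = (\<Sum>t=1..N. (\<omega> t / A N) *\<^sub>R x t)"
  by (simp add: acgd_output_def A_def scaleR_sum_right)

lemma average_weights:
  assumes "1 \<le> N"
  shows "(\<Sum>t=1..N. \<omega> t / A N) = 1" and "t \<in> {1..N} \<Longrightarrow> 0 \<le> \<omega> t / A N"
proof -
  have "(\<Sum>t=1..N. \<omega> t / A N) = (\<Sum>t=1..N. \<omega> t) / A N" by (simp only: sum_divide_distrib)
  also have "\<dots> = A N / A N" by (simp only: A_def)
  finally show "(\<Sum>t=1..N. \<omega> t / A N) = 1" using A_ge_1[OF assms] by simp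
  show "0 \<le> \<omega> t / A N" if "t \<in> {1..N}"
    using A_ge_1[OF assms] omega_ge_1[of t] that by simp
qed

lemma xbar_X:
  assumes "1 \<le> N"
  shows "xbar N \<in> X"
  unfolding xbar_average[OF assms]
  by (rule convex_sum[OF _ convex_X average_weights(1)[OF assms]])
     (use x_X average_weights(2)[OF assms] in auto)

lemma u_xbar_le:
  assumes N: "1 \<le> N"
  shows "A N * u (xbar N) \<le> (\<Sum>t=1..N. \<omega> t * u (x t))"
proof -
  have "convex_on X u"
    using u_sc alpha_pos by (intro strongly_convex_on_imp_convex_on) auto
  then have "u (xbar N) \<le> (\<Sum>t=1..N. \<omega> t / A N * u (x t))"
    unfolding xbar_average[OF N] using N x_X average_weights[OF N]
    by (intro convex_on_sum) auto
  then show ?thesis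
    using A_ge_1[OF N] by (simp add: pos_le_divide_eq mult.commute flip: sum_divide_distrib)
qed

text \<open>The choice of \<open>R\<close> amounts to \<open>K = 2 * L * (norm (x0 - xs) / (norm ls + 1))\<^sup>2\<close>.\<close>

lemma initial_energy: "\<eta> 1 / 2 * (norm (x0 - xs))\<^sup>2 + K * (norm ls)\<^sup>2 \<le> 3 * L * (norm (x0 - xs))\<^sup>2"
proof -
  define r where "r = norm (x0 - xs)"
  have r: "0 < r" using x0 by (simp add: r_def)
  have K: "K = 2 * L * r\<^sup>2 / (norm ls + 1)\<^sup>2"
    unfolding K_def \<Delta>_def unfolding r_def[symmetric]
    using alpha_pos L_pos r by (simp add: power_divide field_simps)
  have "(norm ls)\<^sup>2 \<le> (norm ls + 1)\<^sup>2" by (intro power_mono) auto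
  moreover have "0 < (norm ls + 1)\<^sup>2" by (intro zero_less_power add_nonneg_pos) auto
  ultimately have "(norm ls)\<^sup>2 / (norm ls + 1)\<^sup>2 \<le> 1" by (simp add: divide_le_eq)
  then have "2 * L * r\<^sup>2 * ((norm ls)\<^sup>2 / (norm ls + 1)\<^sup>2) \<le> 2 * L * r\<^sup>2 * 1"
    using L_pos by (intro mult_left_mono) auto
  then have "K * (norm ls)\<^sup>2 \<le> 2 * L * r\<^sup>2" by (simp add: K)
  then show ?thesis unfolding eta_1 r_def by simp
qed

text \<open>The first estimate uses the growth of \<open>F + u\<close>. The second one only uses the proximal term that is left in
the energy and keeps the iterates in a bounded set.\<close>

lemma convergence:
  assumes N: "1 \<le> N"
  shows "A N * (norm (xbar N - xs))\<^sup>2 \<le> 3 * q\<^sup>2 * (norm (x0 - xs))\<^sup>2"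
    and "(norm (x N - xs))\<^sup>2 \<le> 6 * q\<^sup>2 * (norm (x0 - xs))\<^sup>2"
proof -
  have A: "0 < A N" using A_ge_1[OF N] by simp
  have "A N * (f xs + u xs + \<alpha> / 2 * (norm (xbar N - xs))\<^sup>2) \<le> A N * (F (xbar N) + u (xbar N))"
    using kkt_growth[OF xbar_X[OF N]] A by simp
  then have growth: "A N * (f xs + u xs) + \<alpha> / 2 * (A N * (norm (xbar N - xs))\<^sup>2)
      \<le> A N * F (xbar N) + A N * u (xbar N)"
    by (simp add: distrib_left mult.left_commute)
  have "1 * (\<alpha> / 4 * (norm (x N - xs))\<^sup>2) \<le> \<omega> N * ((\<eta> N + \<alpha> / 2) / 2 * (norm (x N - xs))\<^sup>2)"
    using omega_ge_1[OF N] eta_pos[OF N] alpha_pos by (intro mult_mono mult_right_mono) auto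
  moreover have "0 \<le> \<Phi> N (S N)" using inner_ge_1[OF N] N by (intro Phi_nonneg) auto
  ultimately have main: "\<alpha> / 2 * (A N * (norm (xbar N - xs))\<^sup>2) + \<alpha> / 4 * (norm (x N - xs))\<^sup>2
      \<le> 3 * L * (norm (x0 - xs))\<^sup>2"
    using growth u_xbar_le[OF N] energy_bound[OF N] initial_energy by linarith
  have L: "3 * L * (norm (x0 - xs))\<^sup>2 = \<alpha> / 2 * (3 * q\<^sup>2 * (norm (x0 - xs))\<^sup>2)"
    using alpha_pos by (simp add: q_sq)
  have "0 \<le> \<alpha> / 4 * (norm (x N - xs))\<^sup>2" using alpha_pos by simp
  with main have "\<alpha> / 2 * (A N * (norm (xbar N - xs))\<^sup>2) \<le> \<alpha> / 2 * (3 * q\<^sup>2 * (norm (x0 - xs))\<^sup>2)"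
    unfolding L by linarith
  then show "A N * (norm (xbar N - xs))\<^sup>2 \<le> 3 * q\<^sup>2 * (norm (x0 - xs))\<^sup>2"
    using alpha_pos by (subst (asm) mult_le_cancel_left_pos) auto
  have "0 \<le> \<alpha> / 2 * (A N * (norm (xbar N - xs))\<^sup>2)" using alpha_pos A by simp
  with main have "\<alpha> / 4 * (norm (x N - xs))\<^sup>2 \<le> \<alpha> / 4 * (6 * q\<^sup>2 * (norm (x0 - xs))\<^sup>2)"
    unfolding L by simp
  then show "(norm (x N - xs))\<^sup>2 \<le> 6 * q\<^sup>2 * (norm (x0 - xs))\<^sup>2"
    using alpha_pos by (subst (asm) mult_le_cancel_left_pos) auto
qed

text \<open>By \<open>A_xu\<close> each $\underline x^t$ is a convex combination of an average and an iterate, both of which stay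
in a fixed ball around \<open>xs\<close> by \<open>convergence\<close>.\<close>

lemma bounded_xu: "bounded (range xu)"
proof -
  define C where "C = sqrt 6 * q * norm (x0 - xs)"
  have C2: "C\<^sup>2 = 6 * q\<^sup>2 * (norm (x0 - xs))\<^sup>2" by (simp add: C_def power_mult_distrib)
  have C0: "norm (x0 - xs) \<le> C"
  proof -
    have "1 * 1 \<le> sqrt 6 * q" using q_ge_1 by (intro mult_mono) auto
    then show ?thesis unfolding C_def using mult_right_mono[of 1 "sqrt 6 * q" "norm (x0 - xs)"] by simp
  qed
  then have C: "0 \<le> C" using norm_ge_zero order_trans by blast
  have x: "norm (x n - xs) \<le> C" for n
  proof (cases "n = 0")
    case True then show ?thesis using C0 run_init by simp
  next
    case False
    then have "(norm (x n - xs))\<^sup>2 \<le> C\<^sup>2" using convergence(2)[of n] C2 by simp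
    then show ?thesis using C by (rule power2_le_imp_le)
  qed
  have xb: "norm (xbar n - xs) \<le> C" if n: "1 \<le> n" for n
  proof -
    have "1 * (norm (xbar n - xs))\<^sup>2 \<le> A n * (norm (xbar n - xs))\<^sup>2"
      using A_ge_1[OF n] by (intro mult_right_mono) auto
    also have "\<dots> \<le> 3 * q\<^sup>2 * (norm (x0 - xs))\<^sup>2" by (rule convergence(1)[OF n])
    also have "\<dots> \<le> C\<^sup>2" unfolding C2 by (intro mult_right_mono) auto
    finally have "(norm (xbar n - xs))\<^sup>2 \<le> C\<^sup>2" by simp
    then show ?thesis using C by (rule power2_le_imp_le)
  qed
  have "norm (xu t - xs) \<le> C" for t
  proof (cases t)
    case 0 then show ?thesis using C0 run_init by simp
  next
    case (Suc n)
    have A: "0 < A t" "0 < \<omega> t" using A_ge_1[of t] omega_ge_1[of t] Suc by auto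
    have "A t *\<^sub>R (xu t - xs) = A n *\<^sub>R (xbar n - xs) + \<omega> t *\<^sub>R (x n - xs)"
      using A_xu[of n] by (simp add: Suc A_Suc scaleR_diff_right scaleR_add_left)
    then have "A t * norm (xu t - xs) \<le> norm (A n *\<^sub>R (xbar n - xs)) + norm (\<omega> t *\<^sub>R (x n - xs))"
      using A by (metis abs_of_pos norm_scaleR norm_triangle_ineq)
    also have "\<dots> \<le> A n * C + \<omega> t * C"
    proof (rule add_mono)
      show "norm (A n *\<^sub>R (xbar n - xs)) \<le> A n * C"
        using xb[of n] A_ge_1[of n] by (cases "n = 0") (auto simp: A_def)
      show "norm (\<omega> t *\<^sub>R (x n - xs)) \<le> \<omega> t * C" using x[of n] A by simp
    qed
    also have "\<dots> = A t * C" by (simp add: Suc A_Suc distrib_right)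
    finally show ?thesis using A by simp
  qed
  then have "range xu \<subseteq> cball xs C" by (auto simp: dist_norm norm_minus_commute)
  then show ?thesis using bounded_cball bounded_subset by blast
qed

end

section \<open>Complexity\<close>

lemma (in acgd_run) close_outputI:
  assumes eps: "0 < \<epsilon>" and N: "1 \<le> N" and A: "3 * q\<^sup>2 * (norm (x0 - xs))\<^sup>2 / \<epsilon> \<le> A N"
  shows "close_output P Z xs \<epsilon> N"
proof -
  have "A N * (norm (xbar N - xs))\<^sup>2 \<le> 3 * q\<^sup>2 * (norm (x0 - xs))\<^sup>2" by (rule convergence(1)[OF N])
  also have "\<dots> \<le> A N * \<epsilon>" using A eps by (simp add: pos_divide_le_eq)
  finally have "(norm (xbar N - xs))\<^sup>2 \<le> \<epsilon>"
    using A_ge_1[OF N] by (subst (asm) mult_le_cancel_left_pos) auto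
  then show ?thesis using N by (simp add: close_output_def)
qed

lemma (in acgd_run) close_output_after_bound:
  assumes eps: "0 < \<epsilon>"
    and N: "\<lceil>(q + 1) * ln (1 + 3 * q * (norm (x0 - xs))\<^sup>2 / \<epsilon>)\<rceil> + 4 \<le> int N"
  shows "close_output P Z xs \<epsilon> N"
proof (rule close_outputI[OF eps])
  have e: "0 \<le> 3 * q * (norm (x0 - xs))\<^sup>2 / \<epsilon>" using q_ge_1 eps by simp
  have "q * (3 * q * (norm (x0 - xs))\<^sup>2 / \<epsilon>) \<le> A N" by (rule A_ge[OF e N])
  then show "3 * q\<^sup>2 * (norm (x0 - xs))\<^sup>2 / \<epsilon> \<le> A N"
    by (simp add: power2_eq_square mult_ac)
  have "0 \<le> (q + 1) * ln (1 + 3 * q * (norm (x0 - xs))\<^sup>2 / \<epsilon>)" using q_ge_1 e by simp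
  then show "1 \<le> N" using N by linarith
qed

lemma (in acgd_run) close_output_oracle_evaluations:
  assumes "0 < \<epsilon>"
  shows "close_output P Z xs \<epsilon> (oracle_evaluations P Z xs \<epsilon>)"
proof -
  obtain N where "\<lceil>(q + 1) * ln (1 + 3 * q * (norm (x0 - xs))\<^sup>2 / \<epsilon>)\<rceil> + 4 \<le> int N"
    by (meson nat_le_iff order_refl)
  then show ?thesis
    unfolding oracle_evaluations_def by (intro LeastI) (rule close_output_after_bound[OF assms])
qed

text \<open>One phase before the first success \<open>A\<close> is still below the threshold of \<open>close_outputI\<close>, and it at most
triples in a phase. If the first phase succeeds, \<open>A 1 = 1\<close>.\<close>

lemma (in acgd_run) A_oracle_evaluations_le:
  assumes eps: "0 < \<epsilon>"
  shows "A (oracle_evaluations P Z xs \<epsilon>) \<le> 3 * max 1 (3 * q\<^sup>2 * (norm (x0 - xs))\<^sup>2 / \<epsilon>)"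
proof (cases "oracle_evaluations P Z xs \<epsilon> = 1")
  case True
  then show ?thesis using omega_1 by (simp add: A_def)
next
  case False
  define n where "n = oracle_evaluations P Z xs \<epsilon> - 1"
  have N: "oracle_evaluations P Z xs \<epsilon> = Suc n" and n: "1 \<le> n"
    using False close_output_oracle_evaluations[OF eps] by (auto simp: n_def close_output_def)
  have "\<not> close_output P Z xs \<epsilon> n"
    using not_less_Least[of n "close_output P Z xs \<epsilon>"] N by (simp add: oracle_evaluations_def)
  then have "A n \<le> 3 * q\<^sup>2 * (norm (x0 - xs))\<^sup>2 / \<epsilon>"
    using close_outputI[OF eps n] by linarith
  then show ?thesis using A_Suc_le[OF n] unfolding N by linarith
qed

text \<open>The constant 30 exceeds \<open>3 * (sqrt 2 + 3 * sqrt 6)\<close>, where 3 counts the multiplications in an inner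
iteration.\<close>

lemma (in acgd_run) matvec_count_le:
  assumes eps: "0 < \<epsilon>" and mv: "\<And>t s. mv t s \<le> 3"
    and B: "\<And>t. max 1 (matrix_norm (jac g (xu t))) \<le> B"
  shows "real (matvec_count mv P (oracle_evaluations P Z xs \<epsilon>))
    \<le> 30 * (real (oracle_evaluations P Z xs \<epsilon>)
        + B * sqrt \<Delta> * sqrt (max 1 (3 * q\<^sup>2 * (norm (x0 - xs))\<^sup>2 / \<epsilon>)))"
proof -
  define N where "N = oracle_evaluations P Z xs \<epsilon>"
  define m where "m = max 1 (3 * q\<^sup>2 * (norm (x0 - xs))\<^sup>2 / \<epsilon>)"
  have N: "1 \<le> N" using close_output_oracle_evaluations[OF eps] by (simp add: N_def close_output_def)
  have B1: "1 \<le> B" using B[of 0] by simp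
  have M: "M t \<le> B" for t using B[of t] by (auto simp: phase_norm_def Let_def)
  have m: "1 \<le> m" by (simp add: m_def)
  have "matvec_count mv P N \<le> (\<Sum>t=1..N. \<Sum>s=1..S t. 3)"
    unfolding matvec_count_def by (intro sum_mono mv)
  then have "real (matvec_count mv P N) \<le> real (\<Sum>t=1..N. \<Sum>s=1..S t. 3)" by (simp only: of_nat_le_iff)
  also have "\<dots> = 3 * (\<Sum>t=1..N. real (S t))"
    by (simp add: sum_distrib_left mult.commute)
  also have "\<dots> \<le> 3 * (2 * real N + B * (sqrt (2 * \<Delta>) + 3 * sqrt (2 * \<Delta> * A N)))"
    using sum_inner_le[OF N M] by simp
  also have "sqrt (2 * \<Delta>) \<le> 3 / 2 * (sqrt \<Delta> * sqrt m)"
  proof -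
    have "2 * \<Delta> \<le> (3 / 2 * (sqrt \<Delta> * sqrt m))\<^sup>2"
      using m Delta_pos mult_left_mono[of 1 m \<Delta>] by (simp add: power_mult_distrib power_divide)
    then show ?thesis using Delta_pos m by (intro real_le_lsqrt) auto
  qed
  also have "sqrt (2 * \<Delta> * A N) \<le> 5 / 2 * (sqrt \<Delta> * sqrt m)"
  proof -
    have "A N \<le> 3 * m" unfolding N_def m_def by (rule A_oracle_evaluations_le[OF eps])
    then have "2 * \<Delta> * A N \<le> 2 * \<Delta> * (3 * m)" using Delta_pos by (intro mult_left_mono) auto
    also have "\<dots> \<le> (5 / 2 * (sqrt \<Delta> * sqrt m))\<^sup>2"
      using m Delta_pos by (simp add: power_mult_distrib power_divide)
    finally show ?thesis using Delta_pos m by (intro real_le_lsqrt) auto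
  qed
  also have "3 * (2 * real N + B * (3 / 2 * (sqrt \<Delta> * sqrt m) + 3 * (5 / 2 * (sqrt \<Delta> * sqrt m))))
      = 6 * real N + 27 * (B * sqrt \<Delta> * sqrt m)" by (simp add: algebra_simps)
  also have "\<dots> \<le> 30 * (real N + B * sqrt \<Delta> * sqrt m)"
    using B1 Delta_pos m by simp
  finally show ?thesis using B1 unfolding N_def m_def by simp
qed

theorem corollary5:
  fixes X :: "(real^'n) set"
    and f u :: "real^'n \<Rightarrow> real"
    and g :: "real^'n \<Rightarrow> real^'m"
    and \<alpha> \<epsilon> L \<kappa>\<^sub>1 d :: real
    and x0 xs :: "real^'n"
    and ls :: "real^'m"
    and Lc :: "real^'m \<Rightarrow> real"
    and P :: stepsizes
    and Z :: "('n, 'm) iterates"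
    and mv :: "nat \<Rightarrow> nat \<Rightarrow> nat"
  assumes X: "closed X" "convex X"
    and f: "convex_on UNIV f" "\<And>x. f differentiable (at x)"
      "\<exists>C. C-lipschitz_on UNIV (gradient f)"
    and g: "\<And>i. convex_on UNIV (\<lambda>x. g x $ i)" "\<And>x. g differentiable (at x)"
      "\<And>i. \<exists>C. C-lipschitz_on UNIV (gradient (\<lambda>x. g x $ i))"
    and u: "\<alpha> > 0" "strongly_convex_on X \<alpha> u"
    and kkt: "kkt_pair X f g u xs ls"
    and Lc: "lagrangian_smoothness f g Lc" "\<alpha> \<le> Lc 0" "bdd_above (Lc ` dual_region ls 1)"
    and L: "L = (SUP l\<in>dual_region ls 1. Lc l)"
    and \<kappa>\<^sub>1: "\<kappa>\<^sub>1 = L / \<alpha>"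
    and d: "d = norm ls + 1"
    and x0: "x0 \<noteq> xs"
    and \<epsilon>: "\<epsilon> > 0"
    and run: "acgd_s X f g u x0 P Z"
    and rule: "sc_rule \<alpha> L (d / norm (x0 - xs)) (phase_norm g Z) P"
    and mv: "\<And>t s. mv t s \<le> 3"
  shows
    "let bound = \<lceil>(sqrt (2 * \<kappa>\<^sub>1) + 1)
                   * ln (1 + 3 * sqrt (2 * \<kappa>\<^sub>1) * (norm (x0 - xs))\<^sup>2 / \<epsilon>)\<rceil> + 4;
         N\<^sub>\<epsilon> = oracle_evaluations P Z xs \<epsilon>;
         C\<^sub>\<epsilon> = real (matvec_count mv P N\<^sub>\<epsilon>)
     in (\<forall>N. int N \<ge> bound \<longrightarrow> close_output P Z xs \<epsilon> N) \<and>
        int N\<^sub>\<epsilon> \<le> bound \<and>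
        bounded (range (it_xu Z)) \<and>
        (\<forall>B Mbar. bounded B \<and> xs \<in> interior B \<and> range (it_xu Z) \<subseteq> B \<and>
            (\<forall>x\<in>B. max 1 (matrix_norm (jac g x)) \<le> Mbar) \<longrightarrow>
          C\<^sub>\<epsilon> \<le> O_const * (real N\<^sub>\<epsilon> + Mbar * d / (norm (x0 - xs) * sqrt (\<alpha> * L))
                     * sqrt (max 1 (6 * \<kappa>\<^sub>1 * (norm (x0 - xs))\<^sup>2 / \<epsilon>))) \<and>
          (\<epsilon> \<le> 6 * \<kappa>\<^sub>1 * (norm (x0 - xs))\<^sup>2 \<longrightarrow>
            C\<^sub>\<epsilon> \<le> O_const * (Mbar * d / (\<alpha> * sqrt \<epsilon>) + real N\<^sub>\<epsilon>)))"
proof -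
  define r where "r = norm (x0 - xs)"
  have r: "0 < r" using x0 by (simp add: r_def)
  have ls: "ls \<in> orthant" using kkt by (simp add: kkt_pair_def)
  have "0 \<in> dual_region ls 1" "ls \<in> dual_region ls 1"
    by (auto simp: dual_region_def orthant_def intro!: exI[of _ "0 :: real^'m"])
  then have "Lc 0 \<le> L" and Lc_ls: "Lc ls \<le> L"
    unfolding L using Lc(3) by (auto intro: cSUP_upper)
  then have \<alpha>L: "\<alpha> \<le> L" using Lc(2) by linarith
  have L0: "0 < L" using \<alpha>L u(1) by linarith
  have "(Lc ls)-lipschitz_on UNIV (gradient (\<lambda>x. f x + (\<Sum>i\<in>UNIV. ls $ i * g x $ i)))"
    using Lc(1) ls by (simp add: lagrangian_smoothness_def)
  then have smooth: "L-lipschitz_on UNIV (gradient (\<lambda>x. f x + ls \<bullet> g x))"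
    using Lc_ls by (simp add: inner_vec_def lipschitz_on_le)
  obtain \<Gamma> W :: "nat \<Rightarrow> real" where
    sz: "sc_stepsizes \<alpha> L ((norm ls + 1) / norm (x0 - xs)) (phase_norm g Z) P \<Gamma> W"
  proof -
    have "0 < (norm ls + 1) / norm (x0 - xs)" using x0 by (simp add: add_nonneg_pos)
    moreover have "0 < phase_norm g Z t" for t by (simp add: phase_norm_def Let_def)
    ultimately show thesis
      using sc_rule_imp_sc_stepsizes[OF u(1) \<alpha>L _ _ rule[unfolded d]] that by blast
  qed
  interpret acgd_run X f u g \<alpha> L x0 xs ls P Z \<Gamma> W
    by (rule acgd_run.intro) (use f g u kkt smooth x0 run sz in auto)
  have q: "sqrt (2 * \<kappa>\<^sub>1) = q" by (simp add: q_def \<kappa>\<^sub>1)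
  have q2: "3 * q\<^sup>2 = 6 * \<kappa>\<^sub>1" by (simp add: q_sq \<kappa>\<^sub>1)
  define bound where "bound = \<lceil>(sqrt (2 * \<kappa>\<^sub>1) + 1)
      * ln (1 + 3 * sqrt (2 * \<kappa>\<^sub>1) * (norm (x0 - xs))\<^sup>2 / \<epsilon>)\<rceil> + 4"
  define N where "N = oracle_evaluations P Z xs \<epsilon>"
  have close: "close_output P Z xs \<epsilon> n" if "bound \<le> int n" for n
    using close_output_after_bound[OF \<epsilon>] that unfolding bound_def q .
  have "0 \<le> bound"
  proof -
    have "0 \<le> (q + 1) * ln (1 + 3 * q * (norm (x0 - xs))\<^sup>2 / \<epsilon>)" using q_ge_1 \<epsilon> by simp
    then show ?thesis unfolding bound_def q by linarith
  qed
  then have "close_output P Z xs \<epsilon> (nat bound)" by (intro close) simp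
  then have "N \<le> nat bound" unfolding N_def oracle_evaluations_def by (rule Least_le)
  then have N_le: "int N \<le> bound" using \<open>0 \<le> bound\<close> by linarith
  \<comment> \<open>identifies the factor of the second term of the complexity bound\<close>
  have \<Delta>: "sqrt \<Delta> = d / (r * sqrt (\<alpha> * L))"
  proof -
    have "\<Delta> = (d / r)\<^sup>2 / (\<alpha> * L)" by (simp add: \<Delta>_def r_def d)
    then have "sqrt \<Delta> = \<bar>d / r\<bar> / sqrt (\<alpha> * L)" by (simp only: real_sqrt_divide real_sqrt_abs)
    then show ?thesis using r by (simp add: d)
  qed
  have count: "real (matvec_count mv P N) \<le> O_const * (real N + Mbar * d / (r * sqrt (\<alpha> * L))
        * sqrt (max 1 (6 * \<kappa>\<^sub>1 * r\<^sup>2 / \<epsilon>)))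
      \<and> (\<epsilon> \<le> 6 * \<kappa>\<^sub>1 * r\<^sup>2 \<longrightarrow>
          real (matvec_count mv P N) \<le> O_const * (Mbar * d / (\<alpha> * sqrt \<epsilon>) + real N))"
    if B: "range (it_xu Z) \<subseteq> B" "\<forall>x\<in>B. max 1 (matrix_norm (jac g x)) \<le> Mbar" for B Mbar
  proof -
    have bd: "max 1 (matrix_norm (jac g (it_xu Z t))) \<le> Mbar" for t using B by blast
    then have Mbar: "1 \<le> Mbar" by (meson max.bounded_iff)
    define m where "m = max 1 (6 * \<kappa>\<^sub>1 * r\<^sup>2 / \<epsilon>)"
    define c where "c = Mbar * d / (r * sqrt (\<alpha> * L))"
    have d0: "0 < d" by (simp add: d add_nonneg_pos)
    have c0: "0 \<le> c" unfolding c_def using Mbar d0 r u(1) L0 by simp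
    have C: "real (matvec_count mv P N) \<le> 30 * (real N + c * sqrt m)"
      using matvec_count_le[of \<epsilon> mv, OF \<epsilon> mv bd] unfolding \<Delta> q2 N_def m_def r_def c_def by simp
    have "0 \<le> c * sqrt m" using c0 by (simp add: m_def)
    with C have 1: "real (matvec_count mv P N) \<le> O_const * (real N + c * sqrt m)"
      by (simp add: O_const_def)
    have 2: "real (matvec_count mv P N) \<le> O_const * (Mbar * d / (\<alpha> * sqrt \<epsilon>) + real N)"
      if e: "\<epsilon> \<le> 6 * \<kappa>\<^sub>1 * r\<^sup>2"
    proof -
      have "m = 6 * \<kappa>\<^sub>1 * r\<^sup>2 / \<epsilon>" using e \<epsilon> by (simp add: m_def max_def)
      then have "sqrt m = sqrt 6 * sqrt \<kappa>\<^sub>1 * r / sqrt \<epsilon>"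
        using r by (simp add: real_sqrt_mult real_sqrt_divide)
      moreover have "sqrt \<kappa>\<^sub>1 = sqrt (\<alpha> * L) / \<alpha>"
      proof -
        have "\<kappa>\<^sub>1 = \<alpha> * L / \<alpha>\<^sup>2" using u(1) by (simp add: \<kappa>\<^sub>1 power2_eq_square)
        then show ?thesis using u(1) by (simp only: real_sqrt_divide real_sqrt_abs abs_of_pos)
      qed
      \<comment> \<open>the initial distance cancels, and \<open>30 * sqrt 6 < 100\<close>\<close>
      ultimately have "c * sqrt m = sqrt 6 * (Mbar * d / (\<alpha> * sqrt \<epsilon>))"
        using r u(1) L0 unfolding c_def by simp
      also have "\<dots> \<le> 3 * (Mbar * d / (\<alpha> * sqrt \<epsilon>))"
        using Mbar d0 u(1) \<epsilon> by (intro mult_right_mono real_le_lsqrt) auto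
      finally have "c * sqrt m \<le> 3 * (Mbar * d / (\<alpha> * sqrt \<epsilon>))" .
      moreover have "0 \<le> Mbar * d / (\<alpha> * sqrt \<epsilon>)" using Mbar d0 u(1) \<epsilon> by simp
      ultimately show ?thesis using C by (simp add: O_const_def)
    qed
    from 1 2 show ?thesis unfolding c_def m_def by simp
  qed
  show ?thesis
    unfolding Let_def bound_def[symmetric] N_def[symmetric]
    using close N_le bounded_xu count unfolding r_def by blast
qed

end
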